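(* Let $(T,\mathcal T,\lambda)$ be a complete atomless probability space, $\mathcal F$ a countably generated sub-$\sigma$-algebra of $\mathcal T$, and $X$ a separable Banach space. If $\mathcal T$ is nowhere equivalent to $\mathcal F$, then the following hold. (B5) For any $\mathcal F$-measurable, integrably bounded and norm compact valued correspondence $F$ from $T$ to $X$, $I_F^{\mathcal T}$ is norm compact. (B6) Let $G$ be an $\mathcal F$-measurable, integrably bounded and norm compact valued correspondence from $T$ to $X$, let $Y$ be a metric space, and let $F$ be a weakly closed valued correspondence from $T\times Y$ to $X$. If (a) for every $y\in Y$, $F(t,y)\subseteq G(t)$ for $\lambda$-almost all $t\in T$; (b) for every $y\in Y$, $F(\cdot,y)$ is $\mathcal F$-measurable; (c) for every $t\in T$, $F(t,\cdot)$ is norm upper hemicontinuous; then $H(y)=I_{F_y}^{\mathcal T}$, with $F_y=F(\cdot,y)$, is norm upper hemicontinuous from $Y$ to $X$.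
   Context: Nowhere equivalence: $\mathcal T$ is nowhere equivalent to $\mathcal F$ if for every $D\in\mathcal T$ with $\lambda(D)>0$ there is a $\mathcal T$-measurable set $D_0\subseteq D$ such that $\lambda(D_0\triangle D_1)>0$ for every $D_1\in\mathcal F^D:=\{D\cap D':D'\in\mathcal F\}$. Correspondences: a correspondence from $T$ to a set $Z$ assigns to each $t\in T$ a nonempty subset of $Z$. If $Z$ is a topological space, $F$ is $\mathcal F$-measurable if $\{t\in T: F(t)\cap E\ne\emptyset\}\in\mathcal F$ for each closed $E\subseteq Z$; here $X$ carries its norm topology. $F$ is closed (compact, ...) valued if $F(t)$ has this property for $\lambda$-almost all $t$. A selection of $F$ is a mapping $f$ with $f(t)\in F(t)$ for $\lambda$-almost all $t$. $F$ is integrably bounded if there is an integrable real function $h$ with $\sup\{\|x\|:x\in F(t)\}\le h(t)$ for $\lambda$-almost all $t$. A correspondence $F$ from a topological space $Y$ to a topological space $Z$ is upper hemicontinuous if for each $y_0\in Y$ and each open $O_Z\supseteq F(y_0)$ there is an open neighborhood $O_Y$ of $y_0$ with $F(y)\subseteq O_Z$ for all $y\in O_Y$; "norm" means that the target carries its norm topology. $I_F^{\mathcal T}=\{\int_T f\,d\lambda: f$ is a $\mathcal T$-measurable Bochner integrable selection of $F\}$ (Bochner integral). *)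

theory Defs
  imports "HOL-Probability.Probability"
begin

definition atom :: "'a measure \<Rightarrow> 'a set \<Rightarrow> bool" where
  "atom M A \<longleftrightarrow> A \<in> sets M \<and> 0 < emeasure M A \<and>
     (\<forall>B\<in>sets M. B \<subseteq> A \<longrightarrow> emeasure M B = 0 \<or> emeasure M B = emeasure M A)"

definition atomless :: "'a measure \<Rightarrow> bool" where
  "atomless M \<longleftrightarrow> (\<nexists>A. atom M A)"

text \<open>
  A sub-\<open>\<sigma>\<close>-algebra of \<open>sets M\<close> is represented by a measure \<open>N\<close> with \<^term>\<open>subalgebra M N\<close>.
  Only \<open>sets N\<close> and \<open>space N\<close> are relevant; the values of \<open>emeasure N\<close> are never used.
\<close>

definition countably_generated :: "'a measure \<Rightarrow> bool" where
  "countably_generated N \<longleftrightarrow>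
     (\<exists>C. countable C \<and> C \<subseteq> Pow (space N) \<and> sets N = sigma_sets (space N) C)"

definition nowhere_equivalent :: "'a measure \<Rightarrow> 'a measure \<Rightarrow> bool" where
  "nowhere_equivalent M N \<longleftrightarrow>
     (\<forall>D\<in>sets M. 0 < emeasure M D \<longrightarrow>
        (\<exists>D0\<in>sets M. D0 \<subseteq> D \<and>
           (\<forall>D1\<in>{D \<inter> D' | D'. D' \<in> sets N}. 0 < emeasure M (sym_diff D0 D1))))"

definition correspondence :: "'t set \<Rightarrow> ('t \<Rightarrow> 'z set) \<Rightarrow> bool" where
  "correspondence S F \<longleftrightarrow> (\<forall>t\<in>S. F t \<noteq> {})"

definition measurable_correspondence ::
    "'a measure \<Rightarrow> ('a \<Rightarrow> 'z::topological_space set) \<Rightarrow> bool" where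
  "measurable_correspondence N F \<longleftrightarrow>
     correspondence (space N) F \<and>
     (\<forall>E. closed E \<longrightarrow> {t \<in> space N. F t \<inter> E \<noteq> {}} \<in> sets N)"

definition selection :: "'a measure \<Rightarrow> ('a \<Rightarrow> 'z set) \<Rightarrow> ('a \<Rightarrow> 'z) \<Rightarrow> bool" where
  "selection M F f \<longleftrightarrow> (AE t in M. f t \<in> F t)"

text \<open>
  The bound \<open>sup {\<parallel>x\<parallel> : x \<in> F t} \<le> h t\<close> is written pointwise, since \<^const>\<open>Sup\<close> on the reals
  is unspecified for unbounded sets.
\<close>

definition integrably_bounded ::
    "'a measure \<Rightarrow> ('a \<Rightarrow> 'x::real_normed_vector set) \<Rightarrow> bool" where
  "integrably_bounded M F \<longleftrightarrow>
     (\<exists>h::'a \<Rightarrow> real. integrable M h \<and> (AE t in M. \<forall>x\<in>F t. norm x \<le> h t))"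

definition weak_topology :: "'x::real_normed_vector topology" where
  "weak_topology =
     topology_generated_by {\<phi> -` U | (\<phi> :: 'x \<Rightarrow> real) U. bounded_linear \<phi> \<and> open U}"

definition upper_hemicontinuous ::
    "('y::topological_space \<Rightarrow> 'z::topological_space set) \<Rightarrow> bool" where
  "upper_hemicontinuous F \<longleftrightarrow>
     correspondence UNIV F \<and>
     (\<forall>y0 V. open V \<and> F y0 \<subseteq> V \<longrightarrow> (\<exists>U. open U \<and> y0 \<in> U \<and> (\<forall>y\<in>U. F y \<subseteq> V)))"

definition integral_correspondence ::
    "'a measure \<Rightarrow> ('a \<Rightarrow> 'x::{banach, second_countable_topology} set) \<Rightarrow> 'x set" where
  "integral_correspondence M F =
     {integral\<^sup>L M f | f. f \<in> borel_measurable M \<and> integrable M f \<and> selection M F f}"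

end

theory Submission
  imports Defs "HOL-Complex_Analysis.Great_Picard"
begin

text \<open>
  Nowhere equivalence lets one halve every set of positive measure uniformly over the
  \<open>\<sigma>\<close>-algebra \<open>N\<close>, and an exhaustion argument turns this into a conditional Lyapunov theorem:
  every charge on \<open>N\<close> dominated by \<open>B \<mapsto> \<lambda>(D \<inter> B)\<close> has the form \<open>B \<mapsto> \<lambda>(E \<inter> B)\<close> for some
  \<open>E \<subseteq> D\<close> in \<open>M\<close>.

  Given selections \<open>f n\<close> of \<open>G\<close>, record the events that \<open>f n\<close> lies in \<open>U j\<close>, where the \<open>U j\<close> are
  the balls with radius \<open>(1/2)^m\<close> around a dense sequence. Since \<open>N\<close> is countably generated, along a
  subsequence all finite Boolean combinations of these events, intersected with any \<open>B\<close> in \<open>N\<close>,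
  have converging measure. Descending the binary tree of Boolean combinations, the conditional
  Lyapunov theorem realizes all the limits simultaneously by sets \<open>A' j\<close> in \<open>M\<close>. Compactness of
  \<open>G t\<close> prevents loss of mass, so almost every point lies in some \<open>A' j\<close> of each radius; the
  centres of these balls converge to a function \<open>g\<close> with \<open>\<integral>f n \<longlonglongrightarrow> \<integral>g\<close> that inherits, up to closure,
  every \<open>N\<close>-measurable constraint satisfied by almost all terms of the sequence. This limit
  selection yields compactness directly. For upper hemicontinuity it is applied to the constraints
  \<open>\<Union>n\<ge>k. F (t, y n)\<close>.
\<close>

section \<open>Charges on the sub-sigma-algebra\<close>

text \<open>Finite additivity is what a pointwise limit of measures inherits directly. Domination by
  the finite measure \<open>M\<close> upgrades it to countable additivity, see
  \<open>dominated_charge_measure\<close>.\<close>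

definition dominated_charge :: "'a measure \<Rightarrow> 'a measure \<Rightarrow> ('a set \<Rightarrow> real) \<Rightarrow> bool" where
  "dominated_charge M N \<nu> \<longleftrightarrow>
     (\<forall>A\<in>sets N. 0 \<le> \<nu> A \<and> \<nu> A \<le> measure M A) \<and>
     (\<forall>A\<in>sets N. \<forall>B\<in>sets N. A \<inter> B = {} \<longrightarrow> \<nu> (A \<union> B) = \<nu> A + \<nu> B)"

lemma dominated_chargeI:
  assumes "\<And>A. A \<in> sets N \<Longrightarrow> 0 \<le> \<nu> A" "\<And>A. A \<in> sets N \<Longrightarrow> \<nu> A \<le> measure M A"
    and "\<And>A B. A \<in> sets N \<Longrightarrow> B \<in> sets N \<Longrightarrow> A \<inter> B = {} \<Longrightarrow> \<nu> (A \<union> B) = \<nu> A + \<nu> B"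
  shows "dominated_charge M N \<nu>"
  using assms by (auto simp: dominated_charge_def)

lemma dominated_chargeD:
  assumes "dominated_charge M N \<nu>"
  shows "A \<in> sets N \<Longrightarrow> 0 \<le> \<nu> A" "A \<in> sets N \<Longrightarrow> \<nu> A \<le> measure M A"
    and "A \<in> sets N \<Longrightarrow> B \<in> sets N \<Longrightarrow> A \<inter> B = {} \<Longrightarrow> \<nu> (A \<union> B) = \<nu> A + \<nu> B"
  using assms by (auto simp: dominated_charge_def)

locale finite_measure_subalg = finite_measure M for M :: "'a measure" +
  fixes N :: "'a measure"
  assumes subalg: "subalgebra M N"
begin

lemma space_sub [simp]: "space N = space M"
  using subalg by (simp add: subalgebra_def)

lemma sets_sub: "A \<in> sets N \<Longrightarrow> A \<in> sets M"
  using subalg by (auto simp: subalgebra_def)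

lemma dominated_charge_inter:
  assumes "D \<in> sets M"
  shows "dominated_charge M N (\<lambda>B. measure M (D \<inter> B))"
proof (rule dominated_chargeI)
  fix A B assume AB: "A \<in> sets N" "B \<in> sets N" "A \<inter> B = {}"
  have "measure M (D \<inter> (A \<union> B)) = measure M ((D \<inter> A) \<union> (D \<inter> B))" by (simp add: Int_Un_distrib)
  also have "\<dots> = measure M (D \<inter> A) + measure M (D \<inter> B)"
    using assms AB sets_sub by (intro finite_measure_Union) auto
  finally show "measure M (D \<inter> (A \<union> B)) = measure M (D \<inter> A) + measure M (D \<inter> B)" .
qed (auto intro!: finite_measure_mono sets_sub)

text \<open>If sets of \<open>N\<close> decrease to the empty set, their \<open>M\<close>-measures
  tend to 0 and squeeze \<open>\<nu>\<close>. This continuity at the empty set gives countable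
  additivity, so that the Hahn decomposition becomes available for charges.\<close>

lemma dominated_charge_measure:
  assumes \<nu>: "dominated_charge M N \<nu>"
  obtains K where "finite_measure K" "sets K = sets N" "\<And>A. A \<in> sets N \<Longrightarrow> emeasure K A = ennreal (\<nu> A)"
proof -
  note D = dominated_chargeD[OF \<nu>]
  have empty: "\<nu> {} = 0" using D(1,2)[of "{}"] by auto
  define K where "K = measure_of (space N) (sets N) (\<lambda>A. ennreal (\<nu> A))"
  have pos: "positive (sets N) (\<lambda>A. ennreal (\<nu> A))"
    by (simp add: positive_def empty)
  have "countably_additive (sets N) (\<lambda>A. ennreal (\<nu> A))"
  proof (rule sets.empty_continuous_imp_countably_additive[OF pos])
    show "additive (sets N) (\<lambda>A. ennreal (\<nu> A))"
      unfolding additive_def using D by (auto simp: ennreal_plus)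
    show "\<forall>A\<in>sets N. ennreal (\<nu> A) \<noteq> \<infinity>" by auto
    fix A :: "nat \<Rightarrow> 'a set"
    assume A: "range A \<subseteq> sets N" "decseq A" "(\<Inter>i. A i) = {}"
    have "(\<lambda>i. measure M (A i)) \<longlonglongrightarrow> measure M (\<Inter>i. A i)"
      using A sets_sub by (intro finite_Lim_measure_decseq) auto
    then have lim: "(\<lambda>i. measure M (A i)) \<longlonglongrightarrow> 0" using A by simp
    have "(\<lambda>i. \<nu> (A i)) \<longlonglongrightarrow> 0"
      by (rule tendsto_sandwich[OF _ _ tendsto_const lim]) (use A D in \<open>auto intro!: always_eventually\<close>)
    then show "(\<lambda>i. ennreal (\<nu> (A i))) \<longlonglongrightarrow> 0"
      using tendsto_ennrealI by fastforce
  qed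
  then have K: "emeasure K A = ennreal (\<nu> A)" if "A \<in> sets N" for A
    unfolding K_def using pos that sets.sigma_algebra_axioms[of N] by (intro emeasure_measure_of_sigma)
  have sets: "sets K = sets N" unfolding K_def by (rule sets.sets_measure_of_eq)
  moreover have "finite_measure K"
    using K sets_eq_imp_space_eq[OF sets] by (intro finite_measureI) (metis ennreal_neq_top sets.top infinity_ennreal_def)
  ultimately show ?thesis using K that by blast
qed

lemma charge_Hahn_decomposition:
  assumes "dominated_charge M N \<alpha>" "dominated_charge M N \<beta>"
  obtains Q where "Q \<in> sets N"
    "\<And>B. B \<in> sets N \<Longrightarrow> B \<subseteq> Q \<Longrightarrow> \<alpha> B \<le> \<beta> B"
    "\<And>B. B \<in> sets N \<Longrightarrow> B \<inter> Q = {} \<Longrightarrow> \<beta> B \<le> \<alpha> B"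
proof -
  obtain K where K: "finite_measure K" "sets K = sets N" "\<And>A. A \<in> sets N \<Longrightarrow> emeasure K A = ennreal (\<alpha> A)"
    using dominated_charge_measure[OF assms(1)] by blast
  obtain L where L: "finite_measure L" "sets L = sets N" "\<And>A. A \<in> sets N \<Longrightarrow> emeasure L A = ennreal (\<beta> A)"
    using dominated_charge_measure[OF assms(2)] by blast
  have "\<exists>Y\<in>sets L. (\<forall>X\<in>sets L. X \<subseteq> Y \<longrightarrow> K X \<le> L X) \<and> (\<forall>X\<in>sets L. X \<inter> Y = {} \<longrightarrow> L X \<le> K X)"
    using K L by (intro finite_unsigned_Hahn_decomposition) auto
  then obtain Q where "Q \<in> sets N" "\<And>B. B \<in> sets N \<Longrightarrow> B \<subseteq> Q \<Longrightarrow> ennreal (\<alpha> B) \<le> ennreal (\<beta> B)"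
    "\<And>B. B \<in> sets N \<Longrightarrow> B \<inter> Q = {} \<Longrightarrow> ennreal (\<beta> B) \<le> ennreal (\<alpha> B)"
    using K L by (metis (no_types, lifting))
  then show ?thesis
    using that dominated_chargeD(1)[OF assms(1)] dominated_chargeD(1)[OF assms(2)] by (simp add: ennreal_le_iff)
qed

end

section \<open>Nowhere equivalence and the conditional Lyapunov theorem\<close>

locale nowhere_equivalent_subalg = finite_measure_subalg +
  assumes nowhere: "nowhere_equivalent M N"
begin

text \<open>Nowhere equivalence splits \<open>D\<close> into \<open>D0\<close> and
  \<open>D1 = D - D0\<close>. A Hahn set \<open>Q\<close> in \<open>N\<close> separates the region
  where \<open>D0\<close> is conditionally the smaller part from the region where \<open>D1\<close>
  is. Thus \<open>D0 \<inter> Q\<close> and \<open>D1 - Q\<close> both take at most half of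
  \<open>D\<close> on every set of \<open>N\<close>, and at least one of them has positive
  measure.\<close>

lemma halving:
  assumes D: "D \<in> sets M" "0 < measure M D"
  obtains E where "E \<in> sets M" "E \<subseteq> D" "0 < measure M E"
    "\<And>B. B \<in> sets N \<Longrightarrow> 2 * measure M (E \<inter> B) \<le> measure M (D \<inter> B)"
proof -
  have "0 < emeasure M D" using D by (simp add: emeasure_eq_measure)
  then obtain D0 where D0: "D0 \<in> sets M" "D0 \<subseteq> D"
    and ne0: "\<forall>D1\<in>{D \<inter> D' | D'. D' \<in> sets N}. 0 < emeasure M (sym_diff D0 D1)"
    using nowhere D unfolding nowhere_equivalent_def by blast
  have ne: "0 < emeasure M (sym_diff D0 (D \<inter> B))"
    if "B \<in> sets N" for B
    using ne0 that by blast
  define D1 where "D1 = D - D0"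
  have D1: "D1 \<in> sets M" "D1 \<subseteq> D" using D D0 by (auto simp: D1_def)
  obtain Q where Q: "Q \<in> sets N"
    and le: "\<And>B. B \<in> sets N \<Longrightarrow> B \<subseteq> Q \<Longrightarrow> measure M (D0 \<inter> B) \<le> measure M (D1 \<inter> B)"
    and ge: "\<And>B. B \<in> sets N \<Longrightarrow> B \<inter> Q = {} \<Longrightarrow> measure M (D1 \<inter> B) \<le> measure M (D0 \<inter> B)"
    using charge_Hahn_decomposition[OF dominated_charge_inter[OF D0(1)] dominated_charge_inter[OF D1(1)]]
    by blast
  have split: "measure M (D \<inter> B) = measure M (D0 \<inter> B) + measure M (D1 \<inter> B)" if "B \<in> sets N" for B
  proof -
    have "D \<inter> B = (D0 \<inter> B) \<union> (D1 \<inter> B)" using D0 by (auto simp: D1_def)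
    moreover have "(D0 \<inter> B) \<inter> (D1 \<inter> B) = {}" by (auto simp: D1_def)
    ultimately show ?thesis using that D0 D1 sets_sub[of B] finite_measure_Union by auto
  qed
  have Q': "Q \<in> sets M" using Q sets_sub by auto
  \<comment> \<open>This trace of \<open>N\<close> on \<open>D\<close> is chosen so that its
    symmetric difference with \<open>D0\<close> is exactly the union of the two candidates.\<close>
  have "0 < emeasure M (sym_diff D0 (D \<inter> (space M - Q)))" using Q sets.compl_sets[of Q N] by (intro ne) simp
  also have "sym_diff D0 (D \<inter> (space M - Q)) = (D0 \<inter> Q) \<union> (D1 - Q)"
    using D D0 sets.sets_into_space by (fastforce simp: D1_def)
  finally have "0 < measure M ((D0 \<inter> Q) \<union> (D1 - Q))"
    by (simp add: emeasure_eq_measure)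
  also have "\<dots> \<le> measure M (D0 \<inter> Q) + measure M (D1 - Q)"
    using D0 D1 Q' by (intro measure_Un_le) auto
  finally consider "0 < measure M (D0 \<inter> Q)" | "0 < measure M (D1 - Q)" by linarith
  then show ?thesis
  proof cases
    case 1
    show ?thesis
    proof (rule that[OF _ _ 1])
      fix B assume B: "B \<in> sets N"
      have "2 * measure M (D0 \<inter> Q \<inter> B) \<le> measure M (D \<inter> (Q \<inter> B))"
        using split[of "Q \<inter> B"] le[of "Q \<inter> B"] B Q by (auto simp: Int_assoc)
      also have "\<dots> \<le> measure M (D \<inter> B)"
        using B Q D sets_sub by (intro finite_measure_mono) auto
      finally show "2 * measure M (D0 \<inter> Q \<inter> B) \<le> measure M (D \<inter> B)" .
    qed (use D0 Q' in auto)
  next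
    case 2
    show ?thesis
    proof (rule that[OF _ _ 2])
      fix B assume B: "B \<in> sets N"
      have eq: "(D1 - Q) \<inter> B = D1 \<inter> (B - Q)" by auto
      have "2 * measure M ((D1 - Q) \<inter> B) \<le> measure M (D \<inter> (B - Q))"
        unfolding eq using split[of "B - Q"] ge[of "B - Q"] B Q by auto
      also have "\<dots> \<le> measure M (D \<inter> B)"
        using B Q D sets_sub by (intro finite_measure_mono) auto
      finally show "2 * measure M ((D1 - Q) \<inter> B) \<le> measure M (D \<inter> B)" .
    qed (use D1 Q' in auto)
  qed
qed

text \<open>Iterating \<open>halving\<close> \<open>n\<close> times makes the conditional
  probability of \<open>E\<close> given \<open>N\<close> at most \<open>2 ^ -n\<close> times that of
  \<open>D\<close>.\<close>

lemma small_conditional_probability: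
  assumes D: "D \<in> sets M" "0 < measure M D"
  shows "\<exists>E\<in>sets M. E \<subseteq> D \<and> 0 < measure M E \<and>
    (\<forall>B\<in>sets N. 2 ^ n * measure M (E \<inter> B) \<le> measure M (D \<inter> B))"
proof (induction n)
  case 0
  then show ?case using D by auto
next
  case (Suc n)
  then obtain E where E: "E \<in> sets M" "E \<subseteq> D" "0 < measure M E"
    "\<And>B. B \<in> sets N \<Longrightarrow> 2 ^ n * measure M (E \<inter> B) \<le> measure M (D \<inter> B)" by blast
  obtain E' where E': "E' \<in> sets M" "E' \<subseteq> E" "0 < measure M E'"
    "\<And>B. B \<in> sets N \<Longrightarrow> 2 * measure M (E' \<inter> B) \<le> measure M (E \<inter> B)"
    using halving[OF E(1,3)] by blast
  have "2 ^ Suc n * measure M (E' \<inter> B) \<le> measure M (D \<inter> B)" if "B \<in> sets N" for B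
  proof -
    have "2 ^ n * (2 * measure M (E' \<inter> B)) \<le> 2 ^ n * measure M (E \<inter> B)"
      using E'(4)[OF that] by (intro mult_left_mono) auto
    also have "\<dots> \<le> measure M (D \<inter> B)" by (rule E(4)[OF that])
    finally show ?thesis by (simp add: mult.assoc mult.left_commute)
  qed
  with E E' show ?case by (intro bexI[of _ E']) auto
qed

text \<open>On a suitable \<open>Q\<close> in \<open>N\<close> the density of \<open>\<nu>\<close>
  is at least some \<open>\<delta> > 0\<close>. A subset of \<open>D \<inter> Q\<close> whose
  conditional probability is below \<open>\<delta>\<close> therefore stays below
  \<open>\<nu>\<close> on all of \<open>N\<close>.\<close>

lemma conditional_Lyapunov_positive:
  assumes D: "D \<in> sets M"
    and \<nu>: "dominated_charge M N \<nu>" "\<And>B. B \<in> sets N \<Longrightarrow> \<nu> B \<le> measure M (D \<inter> B)"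
    and pos: "0 < \<nu> (space M)"
  obtains E where "E \<in> sets M" "E \<subseteq> D" "0 < measure M E"
    "\<And>B. B \<in> sets N \<Longrightarrow> measure M (E \<inter> B) \<le> \<nu> B"
proof -
  note \<nu>D = dominated_chargeD[OF \<nu>(1)]
  have top: "space M \<in> sets N" using sets.top[of N] by simp
  have le: "\<nu> (space M) \<le> measure M (space M)" using \<nu>D(2) top by simp
  have Mpos: "0 < measure M (space M)" using pos le by linarith
  \<comment> \<open>Half of the average density of \<open>\<nu>\<close>, so that
    \<open>\<delta>\<close> times \<open>M\<close> has strictly less total mass than
    \<open>\<nu>\<close>. The cap at 1 makes this multiple of \<open>M\<close> a dominated
    charge.\<close>
  define \<delta> where "\<delta> = min 1 (\<nu> (space M) / (2 * measure M (space M)))"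
  have \<delta>: "0 < \<delta>" "\<delta> \<le> 1" "\<delta> * measure M (space M) < \<nu> (space M)"
  proof -
    show "0 < \<delta>" "\<delta> \<le> 1" using pos Mpos by (auto simp: \<delta>_def)
    have "\<delta> * measure M (space M) \<le> \<nu> (space M) / (2 * measure M (space M)) * measure M (space M)"
      by (intro mult_right_mono) (auto simp: \<delta>_def)
    also have "\<dots> < \<nu> (space M)" using pos Mpos by simp
    finally show "\<delta> * measure M (space M) < \<nu> (space M)" .
  qed
  have "dominated_charge M N (\<lambda>B. \<delta> * measure M B)"
  proof (rule dominated_chargeI)
    fix A B assume "A \<in> sets N" "B \<in> sets N" "A \<inter> B = {}"
    then show "\<delta> * measure M (A \<union> B) = \<delta> * measure M A + \<delta> * measure M B"
      using finite_measure_Union[of A B] sets_sub by (simp add: distrib_left)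
  qed (use \<delta> in \<open>auto simp: mult_left_le_one_le\<close>)
  then obtain Q where Q: "Q \<in> sets N"
    and le: "\<And>B. B \<in> sets N \<Longrightarrow> B \<subseteq> Q \<Longrightarrow> \<delta> * measure M B \<le> \<nu> B"
    and ge: "\<And>B. B \<in> sets N \<Longrightarrow> B \<inter> Q = {} \<Longrightarrow> \<nu> B \<le> \<delta> * measure M B"
    using charge_Hahn_decomposition[OF _ \<nu>(1)] by blast
  have Q': "Q \<in> sets M" "Q \<subseteq> space M" using Q sets_sub sets.sets_into_space by auto
  \<comment> \<open>Otherwise all mass of \<open>\<nu>\<close> lies off \<open>Q\<close>, where it
    is at most \<open>\<delta>\<close> times \<open>M\<close>; this contradicts the choice of
    \<open>\<delta>\<close>.\<close>
  have "0 < \<nu> Q"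
  proof (rule ccontr)
    assume "\<not> 0 < \<nu> Q"
    moreover have "\<nu> (Q \<union> (space M - Q)) = \<nu> Q + \<nu> (space M - Q)"
      using Q top by (intro \<nu>D(3)) auto
    moreover have "Q \<union> (space M - Q) = space M" using Q' by auto
    moreover have "\<nu> (space M - Q) \<le> \<delta> * measure M (space M - Q)"
      using Q top by (intro ge) auto
    moreover have "\<delta> * measure M (space M - Q) \<le> \<delta> * measure M (space M)"
      using \<delta> by (intro mult_left_mono bounded_measure) auto
    ultimately show False using \<delta>(3) by simp
  qed
  then have "0 < measure M (D \<inter> Q)" using \<nu>(2)[OF Q] by linarith
  moreover obtain n :: nat where n: "1 / \<delta> < 2 ^ n"
    using real_arch_pow[of 2 "1 / \<delta>"] by auto
  ultimately obtain E where E: "E \<in> sets M" "E \<subseteq> D \<inter> Q" "0 < measure M E"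
    and EB: "\<And>B. B \<in> sets N \<Longrightarrow> 2 ^ n * measure M (E \<inter> B) \<le> measure M (D \<inter> Q \<inter> B)"
    using small_conditional_probability[of "D \<inter> Q" n] D Q' by blast
  show ?thesis
  proof (rule that[OF E(1) _ E(3)])
    fix B assume B: "B \<in> sets N"
    have "1 \<le> \<delta> * 2 ^ n" using n \<delta> by (simp add: field_simps)
    then have "measure M (E \<inter> B) \<le> \<delta> * 2 ^ n * measure M (E \<inter> B)"
      using mult_right_mono[of 1 "\<delta> * 2 ^ n" "measure M (E \<inter> B)"] by simp
    also have "\<dots> \<le> \<delta> * measure M (D \<inter> Q \<inter> B)"
      using mult_left_mono[OF EB[OF B], of \<delta>] \<delta> by (simp add: mult.assoc)
    also have "\<dots> \<le> \<delta> * measure M (Q \<inter> B)"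
      using \<delta> Q' B sets_sub D by (intro mult_left_mono finite_measure_mono) auto
    also have "\<dots> \<le> \<nu> (Q \<inter> B)" using Q B by (intro le) auto
    also have "\<dots> \<le> \<nu> (Q \<inter> B) + \<nu> (B - Q)" using \<nu>D(1)[of "B - Q"] Q B by auto
    also have "\<dots> = \<nu> (Q \<inter> B \<union> (B - Q))" using Q B by (intro \<nu>D(3)[symmetric]) auto
    also have "Q \<inter> B \<union> (B - Q) = B" by auto
    finally show "measure M (E \<inter> B) \<le> \<nu> B" .
  qed (use E in auto)
qed

text \<open>Exhaustion: among the subsets of \<open>D\<close> that stay below \<open>\<nu>\<close>
  on \<open>N\<close>, a maximal one \<open>U\<close> is obtained as an increasing union. Missing
  mass could be filled by \<open>conditional_Lyapunov_positive\<close>, so the total mass of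
  \<open>U\<close> is that of \<open>\<nu>\<close>.\<close>

lemma conditional_Lyapunov:
  assumes D: "D \<in> sets M"
    and \<nu>: "dominated_charge M N \<nu>" "\<And>B. B \<in> sets N \<Longrightarrow> \<nu> B \<le> measure M (D \<inter> B)"
  obtains E where "E \<in> sets M" "E \<subseteq> D" "\<And>B. B \<in> sets N \<Longrightarrow> measure M (E \<inter> B) = \<nu> B"
proof -
  note \<nu>D = dominated_chargeD[OF \<nu>(1)]
  have top: "space M \<in> sets N" using sets.top[of N] by simp
  define P where "P S \<longleftrightarrow> S \<in> sets M \<and> S \<subseteq> D \<and> (\<forall>B\<in>sets N. measure M (S \<inter> B) \<le> \<nu> B)" for S
  \<comment> \<open>Greedy choice: \<open>S'\<close> comes within \<open>(1/2) ^ n\<close> of the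
    supremum of the measures of all admissible supersets of \<open>S\<close>. Any admissible
    superset of the final union contains every stage, so its measure is bounded by all these
    near-suprema.\<close>
  have step: "\<exists>S'. P S' \<and> S \<subseteq> S' \<and> (\<forall>R. P R \<longrightarrow> S \<subseteq> R \<longrightarrow> measure M R \<le> measure M S' + (1/2) ^ n)"
    if "P S" for S and n :: nat
  proof -
    define X where "X = measure M ` {R. P R \<and> S \<subseteq> R}"
    have X: "X \<noteq> {}" "bdd_above X"
      using that by (auto simp: X_def intro!: bdd_aboveI[of _ "measure M (space M)"] bounded_measure)
    have "Sup X - (1/2) ^ n < Sup X" by simp
    then obtain x where "x \<in> X" "Sup X - (1/2) ^ n < x"
      using less_cSup_iff[OF X] by auto
    then obtain S' where S': "P S'" "S \<subseteq> S'" "Sup X - (1/2) ^ n < measure M S'"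
      by (auto simp: X_def)
    moreover have "measure M R \<le> Sup X" if "P R" "S \<subseteq> R" for R
      using that X by (intro cSup_upper) (auto simp: X_def)
    ultimately show ?thesis by (intro exI[of _ S']) (smt (verit))
  qed
  have "\<exists>S. \<forall>n::nat. P (S n) \<and> (S n \<subseteq> S (Suc n) \<and>
      (\<forall>R. P R \<longrightarrow> S n \<subseteq> R \<longrightarrow> measure M R \<le> measure M (S (Suc n)) + (1/2) ^ n))"
  proof (rule dependent_nat_choice)
    show "\<exists>S. P S" using \<nu>D(1) by (intro exI[of _ "{}"]) (auto simp: P_def)
  qed (use step in blast)
  then obtain S where S: "\<And>n. P (S n)" "\<And>n. S n \<subseteq> S (Suc n)"
    "\<And>n R. P R \<Longrightarrow> S n \<subseteq> R \<Longrightarrow> measure M R \<le> measure M (S (Suc n)) + (1/2) ^ n" by blast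
  define U where "U = (\<Union>n. S n)"
  have sets_S: "S n \<in> sets M" for n using S(1) by (auto simp: P_def)
  have inc: "incseq S" using S(2) by (rule incseq_SucI)
  have U: "U \<in> sets M" "U \<subseteq> D" using S(1) by (auto simp: U_def P_def)
  have UB: "measure M (U \<inter> B) \<le> \<nu> B" if "B \<in> sets N" for B
  proof (rule LIMSEQ_le_const2)
    have "(\<lambda>n. measure M (S n \<inter> B)) \<longlonglongrightarrow> measure M (\<Union>n. S n \<inter> B)"
      using inc sets_S sets_sub[OF that] by (intro finite_Lim_measure_incseq) (auto simp: incseq_def)
    then show "(\<lambda>n. measure M (S n \<inter> B)) \<longlonglongrightarrow> measure M (U \<inter> B)" by (simp add: U_def)
    show "\<exists>N. \<forall>n\<ge>N. measure M (S n \<inter> B) \<le> \<nu> B" using S(1) that by (auto simp: P_def)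
  qed
  have maximal: "measure M R \<le> measure M U" if "P R" "U \<subseteq> R" for R
  proof (rule LIMSEQ_le_const)
    show "(\<lambda>n. measure M U + (1/2) ^ n) \<longlonglongrightarrow> measure M U"
      using tendsto_add[OF tendsto_const LIMSEQ_power_zero[of "1/2::real"]] by simp
    have "measure M R \<le> measure M U + (1/2) ^ n" for n
    proof -
      have "measure M R \<le> measure M (S (Suc n)) + (1/2) ^ n"
        using that by (intro S(3)) (auto simp: U_def)
      moreover have "measure M (S (Suc n)) \<le> measure M U"
        using U by (intro finite_measure_mono) (auto simp: U_def)
      ultimately show ?thesis by linarith
    qed
    then show "\<exists>N. \<forall>n\<ge>N. measure M R \<le> measure M U + (1/2) ^ n" by blast
  qed
  have total: "\<nu> (space M) \<le> measure M U"
  proof (rule ccontr)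
    assume "\<not> ?thesis"
    then have lt: "measure M U < \<nu> (space M)" by simp
    \<comment> \<open>The part of \<open>\<nu>\<close> not yet absorbed by \<open>U\<close>. It is
      dominated on \<open>D - U\<close>, so positive total mass would yield a set \<open>E\<close>
      there with \<open>U \<union> E\<close> still admissible, against the maximality of
      \<open>U\<close>.\<close>
    define \<nu>' where "\<nu>' B = \<nu> B - measure M (U \<inter> B)" for B
    have "dominated_charge M N \<nu>'"
    proof (rule dominated_chargeI)
      show "0 \<le> \<nu>' A" if "A \<in> sets N" for A using UB[OF that] by (simp add: \<nu>'_def)
      show "\<nu>' A \<le> measure M A" if "A \<in> sets N" for A
        using \<nu>D(2)[OF that] measure_nonneg[of M "U \<inter> A"] unfolding \<nu>'_def by linarith
      show "\<nu>' (A \<union> B) = \<nu>' A + \<nu>' B" if "A \<in> sets N" "B \<in> sets N" "A \<inter> B = {}" for A B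
        using \<nu>D(3)[OF that] dominated_chargeD(3)[OF dominated_charge_inter[OF U(1)] that]
        by (simp add: \<nu>'_def)
    qed
    moreover have "\<nu>' B \<le> measure M ((D - U) \<inter> B)" if "B \<in> sets N" for B
    proof -
      have "(U \<inter> B) \<union> ((D - U) \<inter> B) = D \<inter> B" using U by auto
      moreover have "measure M ((U \<inter> B) \<union> ((D - U) \<inter> B)) = measure M (U \<inter> B) + measure M ((D - U) \<inter> B)"
        using U D sets_sub[OF that] by (intro finite_measure_Union) auto
      ultimately show ?thesis using \<nu>(2)[OF that] by (simp add: \<nu>'_def)
    qed
    moreover have "0 < \<nu>' (space M)"
      using lt U sets.sets_into_space[OF U(1)] by (simp add: \<nu>'_def Int_absorb2)
    ultimately obtain E where E: "E \<in> sets M" "E \<subseteq> D - U" "0 < measure M E"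
      "\<And>B. B \<in> sets N \<Longrightarrow> measure M (E \<inter> B) \<le> \<nu>' B"
      using conditional_Lyapunov_positive[of "D - U" \<nu>'] D U by blast
    have "P (U \<union> E)"
      unfolding P_def
    proof (intro conjI ballI)
      fix B assume B: "B \<in> sets N"
      have "measure M ((U \<inter> B) \<union> (E \<inter> B)) = measure M (U \<inter> B) + measure M (E \<inter> B)"
        using U E sets_sub[OF B] by (intro finite_measure_Union) auto
      then show "measure M ((U \<union> E) \<inter> B) \<le> \<nu> B"
        using E(4)[OF B] by (simp add: \<nu>'_def Int_Un_distrib2)
    qed (use U E in auto)
    then have "measure M (U \<union> E) \<le> measure M U" by (intro maximal) auto
    moreover have "measure M (U \<union> E) = measure M U + measure M E"
      using U E by (intro finite_measure_Union) auto
    ultimately show False using E(3) by simp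
  qed
  show ?thesis
  proof (rule that[OF U])
    fix B assume B: "B \<in> sets N"
    have B': "B \<subseteq> space M" using sets.sets_into_space[OF B] by simp
    have C: "space M - B \<in> sets N" using B top by auto
    \<comment> \<open>The inequality holds on \<open>B\<close> and on its complement, and the totals
      agree, so neither inequality can be strict.\<close>
    have "\<nu> (B \<union> (space M - B)) = \<nu> B + \<nu> (space M - B)"
      using B C by (intro \<nu>D(3)) auto
    moreover have "measure M (U \<inter> (B \<union> (space M - B))) = measure M (U \<inter> B) + measure M (U \<inter> (space M - B))"
      using B C by (intro dominated_chargeD(3)[OF dominated_charge_inter[OF U(1)]]) auto
    moreover have "B \<union> (space M - B) = space M" "U \<inter> space M = U"
      using B' sets.sets_into_space[OF U(1)] by auto
    ultimately show "measure M (U \<inter> B) = \<nu> B"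
      using total UB[OF B] UB[OF C] by simp
  qed
qed

end

section \<open>A subsequence along which measures converge on the sub-sigma-algebra\<close>

context finite_measure_subalg
begin

text \<open>A diagonal argument needs countably many bounded sequences, hence the countable index
  type and a countable generator of \<open>N\<close>. The generator is made stable under
  intersections, so that convergence spreads to \<open>N\<close> by a Dynkin class argument. The
  index \<open>s\<close> will range over lists of Booleans.\<close>

lemma convergent_measure_inter_subseq:
  fixes A :: "'s::countable \<Rightarrow> nat \<Rightarrow> 'a set"
  assumes gen: "countably_generated N" and A: "\<And>s n. A s n \<in> sets M"
  obtains r :: "nat \<Rightarrow> nat" where "strict_mono r"
    "\<And>s B. B \<in> sets N \<Longrightarrow> convergent (\<lambda>n. measure M (A s (r n) \<inter> B))"
proof -
  obtain C where C: "countable C" "C \<subseteq> Pow (space M)" "sets N = sigma_sets (space M) C"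
    using gen by (auto simp: countably_generated_def)
  \<comment> \<open>Finite intersections of generators; the factor \<open>space M\<close> gives the
    empty intersection its meaning and puts \<open>space M\<close> into \<open>G\<close>.\<close>
  define G where "G = (\<lambda>S. space M \<inter> \<Inter>S) ` {S. finite S \<and> S \<subseteq> C}"
  have G: "countable G" "G \<subseteq> Pow (space M)" "Int_stable G"
  proof -
    show "countable G" unfolding G_def using C(1) by (intro countable_image countable_Collect_finite_subset)
    show "G \<subseteq> Pow (space M)" by (auto simp: G_def)
    show "Int_stable G"
    proof (rule Int_stableI)
      fix a b assume "a \<in> G" "b \<in> G"
      then obtain S S' where S: "finite S" "S \<subseteq> C" "a = space M \<inter> \<Inter>S" "finite S'" "S' \<subseteq> C" "b = space M \<inter> \<Inter>S'"
        by (auto simp: G_def)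
      then show "a \<inter> b \<in> G"
        unfolding G_def by (intro image_eqI[where x="S \<union> S'"]) auto
    qed
  qed
  have CG: "C \<subseteq> G"
  proof
    fix c assume "c \<in> C"
    then show "c \<in> G" unfolding G_def using C by (intro image_eqI[where x="{c}"]) auto
  qed
  have "G \<subseteq> sigma_sets (space M) C"
  proof
    fix g assume "g \<in> G"
    then obtain S where S: "finite S" "S \<subseteq> C" "g = space M \<inter> \<Inter>S" by (auto simp: G_def)
    from S(1,2) have "space M \<inter> \<Inter>S \<in> sets N"
    proof (induction S)
      case empty
      then show ?case using sets.top[of N] by simp
    next
      case (insert c S)
      have "c \<in> sets N" using insert C by auto
      then have "c \<inter> (space M \<inter> \<Inter>S) \<in> sets N" using insert by auto
      then show ?case by (simp add: Int_left_commute)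
    qed
    then show "g \<in> sigma_sets (space M) C" using S C by simp
  qed
  then have GN: "sets N = sigma_sets (space M) G"
    unfolding C(3) using CG sigma_sets_mono[of G "space M" C] sigma_sets_mono'[of C G "space M"] by auto
  have "countable (UNIV \<times> G :: ('s \<times> 'a set) set)" using G by auto
  moreover have "norm (measure M (A (fst x) n \<inter> snd x)) \<le> measure M (space M)" for x n
    by (simp add: bounded_measure)
  ultimately have "\<exists>r::nat \<Rightarrow> nat. strict_mono r \<and>
      (\<forall>x\<in>UNIV \<times> G. \<exists>l. (\<lambda>n. measure M (A (fst x) (r n) \<inter> snd x)) \<longlonglongrightarrow> l)"
    by (rule function_convergent_subsequence[of "UNIV \<times> G" "\<lambda>n x. measure M (A (fst x) n \<inter> snd x)"]) blast
  then obtain r :: "nat \<Rightarrow> nat" where r: "strict_mono r"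
    and lim: "\<And>x. x \<in> UNIV \<times> G \<Longrightarrow> \<exists>l. (\<lambda>n. measure M (A (fst x) (r n) \<inter> snd x)) \<longlonglongrightarrow> l"
    by blast
  have "convergent (\<lambda>n. measure M (A s (r n) \<inter> B))" if "B \<in> sets N" for s B
    using G(3,2) that[unfolded GN]
  proof (induction rule: sigma_sets_induct_disjoint)
    case (basic B)
    then show ?case using lim[of "(s, B)"] by (auto simp: convergent_def)
  next
    case empty
    then show ?case by (simp add: convergent_const)
  next
    case (compl B)
    have space: "space M \<in> G" unfolding G_def by (intro image_eqI[where x="{}"]) auto
    have "measure M (A s (r n) \<inter> (space M - B)) = measure M (A s (r n) \<inter> space M) - measure M (A s (r n) \<inter> B)" for n
    proof -
      have "A s (r n) \<inter> (space M - B) = A s (r n) - A s (r n) \<inter> B"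
        using sets.sets_into_space[OF A] by auto
      moreover have "measure M (A s (r n) - A s (r n) \<inter> B) = measure M (A s (r n)) - measure M (A s (r n) \<inter> B)"
        using compl A sets_sub[of B] by (intro finite_measure_Diff) (auto simp: GN)
      moreover have "A s (r n) \<inter> space M = A s (r n)"
        using sets.sets_into_space[OF A] by auto
      ultimately show ?thesis by simp
    qed
    moreover have "convergent (\<lambda>n. measure M (A s (r n) \<inter> space M))"
      using lim[of "(s, space M)"] space by (auto simp: convergent_def)
    ultimately show ?case using compl by (auto intro: convergent_diff)
  next
    case (union B)
    have B: "B i \<in> sets M" for i using union sets_sub by (auto simp: GN)
    have eq: "measure M (A s (r n) \<inter> (\<Union>i. B i)) = (\<Sum>i. measure M (A s (r n) \<inter> B i))" for n
    proof -
      have "(\<lambda>i. measure M (A s (r n) \<inter> B i)) sums measure M (\<Union>i. A s (r n) \<inter> B i)"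
        using union B A by (intro finite_measure_UNION) (auto simp: disjoint_family_on_def)
      then show ?thesis by (simp add: sums_iff)
    qed
    obtain l where l: "\<And>i. (\<lambda>n. measure M (A s (r n) \<inter> B i)) \<longlonglongrightarrow> l i"
      using union.IH unfolding convergent_def by metis
    \<comment> \<open>The measures of the \<open>B i\<close> form a summable majorant that does not
      depend on \<open>n\<close>, so limit and series may be interchanged.\<close>
    have "(\<lambda>i. measure M (B i)) sums measure M (\<Union>i. B i)"
      using union B by (intro finite_measure_UNION) auto
    then have "summable (\<lambda>i. measure M (B i))" by (simp add: sums_iff)
    moreover have "eventually (\<lambda>(i, n). norm (measure M (A s (r n) \<inter> B i)) \<le> measure M (B i))
        (sequentially \<times>\<^sub>F sequentially)"
      using B A by (intro always_eventually) (auto intro!: finite_measure_mono)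
    ultimately have "(\<lambda>n. \<Sum>i. measure M (A s (r n) \<inter> B i)) \<longlonglongrightarrow> (\<Sum>i. l i)"
      using tannerys_theorem[of "\<lambda>i n. measure M (A s (r n) \<inter> B i)" l sequentially "\<lambda>i. measure M (B i)"] l
      by simp
    then show ?case unfolding eq by (auto simp: convergent_def)
  qed
  then show ?thesis by (rule that[OF r])
qed

end

section \<open>Finite Boolean combinations and the tree of cells\<close>

text \<open>The head of the list \<open>s\<close> decides membership in \<open>A (length s - 1)\<close>, its last element
  membership in \<open>A 0\<close>.\<close>

primrec cell :: "'a set \<Rightarrow> (nat \<Rightarrow> 'a set) \<Rightarrow> bool list \<Rightarrow> 'a set" where
  "cell \<Omega> A [] = \<Omega>"
| "cell \<Omega> A (b # s) = (if b then cell \<Omega> A s \<inter> A (length s) else cell \<Omega> A s - A (length s))"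

lemma cell_iff: "t \<in> cell \<Omega> A s \<longleftrightarrow> t \<in> \<Omega> \<and> (\<forall>j<length s. rev s ! j \<longleftrightarrow> t \<in> A j)"
proof (induction s)
  case (Cons b s)
  have "(\<forall>j<length (b # s). rev (b # s) ! j \<longleftrightarrow> t \<in> A j) \<longleftrightarrow>
      (\<forall>j<length s. rev s ! j \<longleftrightarrow> t \<in> A j) \<and> (b \<longleftrightarrow> t \<in> A (length s))"
    by (simp add: All_less_Suc nth_append conj_commute)
  then show ?case using Cons by simp
qed simp

lemma cell_disjoint:
  assumes "length s = length s'" "t \<in> cell \<Omega> A s" "t \<in> cell \<Omega> A s'"
  shows "s = s'"
proof -
  have "rev s = rev s'" using assms by (intro nth_equalityI) (auto simp: cell_iff)
  then show ?thesis by simp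
qed

lemma sets_cell: "(\<And>j. A j \<in> sets M) \<Longrightarrow> cell (space M) A s \<in> sets M"
  by (induction s) auto

text \<open>A set \<open>K s\<close> may be split independently at every node, yet one sequence of
  sets describes the whole tree: its \<open>j\<close>-th member collects the \<open>True\<close>
  children of all nodes of depth \<open>j\<close>. Nodes of equal depth are disjoint, so
  intersecting with \<open>K s\<close> recovers the child of \<open>s\<close> alone.\<close>

lemma binary_tree_eq_cell:
  assumes "K [] = \<Omega>" "\<And>s. K (True # s) \<subseteq> K s" "\<And>s. K (False # s) = K s - K (True # s)"
  shows "K s = cell \<Omega> (\<lambda>j. \<Union>s\<in>{s. length s = j}. K (True # s)) s"
proof -
  have disj: "length s = length s' \<Longrightarrow> t \<in> K s \<Longrightarrow> t \<in> K s' \<Longrightarrow> s = s'" for s s' t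
  proof (induction s arbitrary: s')
    case (Cons b s)
    then obtain b' u where s': "s' = b' # u" "length u = length s" by (cases s') auto
    have sub: "K (b # s) \<subseteq> K s" for b s using assms(2,3) by (cases b) auto
    have "t \<in> K s" "t \<in> K u" using Cons.prems s' sub by auto
    then have "s = u" using Cons.IH[of u] s' by simp
    moreover have "b = b'" using Cons.prems(2,3) s'(1) \<open>s = u\<close> assms(3)[of u] by (cases b; cases b') auto
    ultimately show ?case using s' by simp
  qed simp
  show ?thesis
  proof (induction s)
    case (Cons b s)
    have "K (True # s) = K s \<inter> (\<Union>u\<in>{u. length u = length s}. K (True # u))"
    proof (intro set_eqI iffI)
      fix t assume t: "t \<in> K s \<inter> (\<Union>u\<in>{u. length u = length s}. K (True # u))"
      then obtain u where u: "length u = length s" "t \<in> K (True # u)" by blast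
      then have "s = u" using t assms(2)[of u] by (intro disj[of s u t]) auto
      then show "t \<in> K (True # s)" using u by simp
    qed (use assms(2)[of s] in auto)
    then show ?case using Cons assms(3) by (cases b) auto
  qed (simp add: assms)
qed

text \<open>A predicate fed with \<open>\<lambda>j. j \<in> J \<and> S j\<close> sees the truth
  values of \<open>S\<close> on \<open>J\<close> alone; this encodes a Boolean condition on finitely
  many events. Here \<open>P'\<close> is \<open>P\<close> after restriction to \<open>J\<close>,
  which lets the condition be evaluated on cells of length \<open>m\<close>.\<close>

lemma event_initial_segment:
  fixes J :: "nat set" and P :: "(nat \<Rightarrow> bool) \<Rightarrow> bool"
  assumes J: "finite J"
  shows "\<exists>m P'. \<forall>S. P (\<lambda>j. j \<in> J \<and> S j) = P' (\<lambda>j. j < m \<and> S j)"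
proof -
  obtain m where "J \<subseteq> {..<m}" using J unfolding finite_nat_iff_bounded by (elim exE)
  then have m: "\<And>j. j \<in> J \<Longrightarrow> j < m" by auto
  define P' where "P' S = P (\<lambda>j. j \<in> J \<and> S j)" for S
  have "P (\<lambda>j. j \<in> J \<and> S j) = P' (\<lambda>j. j < m \<and> S j)" for S
  proof -
    have "(\<lambda>j. j \<in> J \<and> S j) = (\<lambda>j. j \<in> J \<and> j < m \<and> S j)" using m by auto
    then show ?thesis by (simp add: P'_def)
  qed
  then show ?thesis by (intro exI allI)
qed

context finite_measure_subalg
begin

text \<open>The cells of depth \<open>m\<close> partition the space, and the condition is constant
  on each of them. The event is thus the disjoint union of the cells on which it holds.\<close>

lemma measure_event_eq_sum_cell:
  assumes A: "\<And>j. A j \<in> sets M" and B: "B \<in> sets M"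
  shows "{t\<in>B. P (\<lambda>j. j < m \<and> t \<in> A j)} \<in> sets M"
    and "measure M {t\<in>B. P (\<lambda>j. j < m \<and> t \<in> A j)} =
     (\<Sum>s | length s = m \<and> P (\<lambda>j. j < m \<and> rev s ! j). measure M (cell (space M) A s \<inter> B))"
proof -
  define I where "I = {s. length s = m \<and> P (\<lambda>j. j < m \<and> rev s ! j)}"
  have I: "finite I"
    using finite_lists_length_eq[of "UNIV :: bool set" m] unfolding I_def by (auto intro: finite_subset)
  have eq: "{t\<in>B. P (\<lambda>j. j < m \<and> t \<in> A j)} = (\<Union>s\<in>I. cell (space M) A s \<inter> B)"
  proof (intro set_eqI iffI)
    fix t assume t: "t \<in> {t\<in>B. P (\<lambda>j. j < m \<and> t \<in> A j)}"
    define s where "s = rev (map (\<lambda>j. t \<in> A j) [0..<m])"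
    have s: "length s = m" "\<And>j. j < m \<Longrightarrow> rev s ! j \<longleftrightarrow> t \<in> A j" by (auto simp: s_def)
    then have "(\<lambda>j. j < m \<and> rev s ! j) = (\<lambda>j. j < m \<and> t \<in> A j)" by auto
    then have "s \<in> I" "t \<in> cell (space M) A s \<inter> B"
      using s t sets.sets_into_space[OF B] by (auto simp: I_def cell_iff)
    then show "t \<in> (\<Union>s\<in>I. cell (space M) A s \<inter> B)" by blast
  next
    fix t assume "t \<in> (\<Union>s\<in>I. cell (space M) A s \<inter> B)"
    then obtain s where s: "s \<in> I" "t \<in> cell (space M) A s" "t \<in> B" by blast
    then have "(\<lambda>j. j < m \<and> rev s ! j) = (\<lambda>j. j < m \<and> t \<in> A j)" by (auto simp: I_def cell_iff)
    with s show "t \<in> {t\<in>B. P (\<lambda>j. j < m \<and> t \<in> A j)}" by (auto simp: I_def)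
  qed
  have sets: "cell (space M) A s \<inter> B \<in> sets M" for s using sets_cell[of A M s] A B by auto
  then show "{t\<in>B. P (\<lambda>j. j < m \<and> t \<in> A j)} \<in> sets M" unfolding eq by (intro sets.finite_UN I sets)
  show "measure M {t\<in>B. P (\<lambda>j. j < m \<and> t \<in> A j)} =
     (\<Sum>s | length s = m \<and> P (\<lambda>j. j < m \<and> rev s ! j). measure M (cell (space M) A s \<inter> B))"
    unfolding eq I_def[symmetric]
  proof (intro finite_measure_finite_Union I)
    show "disjoint_family_on (\<lambda>s. cell (space M) A s \<inter> B) I"
      unfolding disjoint_family_on_def I_def using cell_disjoint[of _ _ _ "space M" A] by blast
  qed (use sets in auto)
qed

lemma sets_finite_event:
  fixes P :: "(nat \<Rightarrow> bool) \<Rightarrow> bool"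
  assumes "\<And>j. A j \<in> sets M" "B \<in> sets M" "finite J"
  shows "{t\<in>B. P (\<lambda>j. j \<in> J \<and> t \<in> A j)} \<in> sets M"
proof -
  obtain m P' where P'_all: "\<forall>S. P (\<lambda>j. j \<in> J \<and> S j) = P' (\<lambda>j. j < m \<and> S j)"
    using event_initial_segment[where P = P, OF assms(3)] by (elim exE)
  note P' = P'_all[rule_format]
  show ?thesis
    unfolding P' using measure_event_eq_sum_cell(1)[where P=P' and m=m, OF assms(1,2)] .
qed

end

section \<open>Simultaneous realization of the limits\<close>

context nowhere_equivalent_subalg
begin

text \<open>The limits \<open>\<nu> s\<close> are dominated charges with
  \<open>\<nu> s = \<nu> (True # s) + \<nu> (False # s)\<close>. Starting from the whole space,
  \<open>conditional_Lyapunov\<close> carves out of \<open>K s\<close> a subset carrying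
  \<open>\<nu> (True # s)\<close>, and the remainder carries \<open>\<nu> (False # s)\<close>. By
  \<open>binary_tree_eq_cell\<close> the resulting tree consists of the cells of one sequence
  \<open>A'\<close>.\<close>

lemma realize_limits:
  assumes A: "\<And>j n. A n j \<in> sets M"
    and lim: "\<And>s B. B \<in> sets N \<Longrightarrow> convergent (\<lambda>n. measure M (cell (space M) (A n) s \<inter> B))"
  obtains A' where "\<And>j. A' j \<in> sets M"
    "\<And>s B. B \<in> sets N \<Longrightarrow> (\<lambda>n. measure M (cell (space M) (A n) s \<inter> B)) \<longlonglongrightarrow> measure M (cell (space M) A' s \<inter> B)"
proof -
  define \<nu> where "\<nu> s B = lim (\<lambda>n. measure M (cell (space M) (A n) s \<inter> B))" for s B
  have \<nu>: "(\<lambda>n. measure M (cell (space M) (A n) s \<inter> B)) \<longlonglongrightarrow> \<nu> s B" if "B \<in> sets N" for s B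
    using lim[OF that] by (simp add: \<nu>_def convergent_LIMSEQ_iff)
  have c: "cell (space M) (A n) s \<in> sets M" for n s using A by (intro sets_cell)
  have charge: "dominated_charge M N (\<nu> s)" for s
  proof (rule dominated_chargeI)
    fix B assume B: "B \<in> sets N"
    show "0 \<le> \<nu> s B" by (rule LIMSEQ_le_const[OF \<nu>[OF B]]) auto
    show "\<nu> s B \<le> measure M B"
      using c sets_sub[OF B] by (intro LIMSEQ_le_const2[OF \<nu>[OF B]]) (auto intro!: finite_measure_mono)
  next
    fix B B' assume B: "B \<in> sets N" "B' \<in> sets N" "B \<inter> B' = {}"
    have "(\<lambda>n. measure M (cell (space M) (A n) s \<inter> (B \<union> B'))) \<longlonglongrightarrow> \<nu> s B + \<nu> s B'"
      using tendsto_add[OF \<nu>[OF B(1)] \<nu>[OF B(2)], of s s] dominated_chargeD(3)[OF dominated_charge_inter[OF c] B]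
      by simp
    moreover have "(\<lambda>n. measure M (cell (space M) (A n) s \<inter> (B \<union> B'))) \<longlonglongrightarrow> \<nu> s (B \<union> B')"
      using B by (intro \<nu>) auto
    ultimately show "\<nu> s (B \<union> B') = \<nu> s B + \<nu> s B'" using LIMSEQ_unique by blast
  qed
  have split: "\<nu> s B = \<nu> (True # s) B + \<nu> (False # s) B" if B: "B \<in> sets N" for s B
  proof -
    have "measure M (cell (space M) (A n) s \<inter> B) =
      measure M (cell (space M) (A n) (True # s) \<inter> B) + measure M (cell (space M) (A n) (False # s) \<inter> B)" for n
    proof -
      have "cell (space M) (A n) s \<inter> B = (cell (space M) (A n) (True # s) \<inter> B) \<union> (cell (space M) (A n) (False # s) \<inter> B)"
        by auto
      also have "measure M \<dots> = measure M (cell (space M) (A n) (True # s) \<inter> B) + measure M (cell (space M) (A n) (False # s) \<inter> B)"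
        using c[of n "True # s"] c[of n "False # s"] sets_sub[OF B] by (intro finite_measure_Union) auto
      finally show ?thesis .
    qed
    then have "(\<lambda>n. measure M (cell (space M) (A n) s \<inter> B)) \<longlonglongrightarrow> \<nu> (True # s) B + \<nu> (False # s) B"
      using tendsto_add[OF \<nu>[OF B, of "True # s"] \<nu>[OF B, of "False # s"]] by (simp only:)
    then show ?thesis using \<nu>[OF B] LIMSEQ_unique by blast
  qed
  define good where "good D s E \<longleftrightarrow> E \<in> sets M \<and> E \<subseteq> D \<and> (\<forall>B\<in>sets N. measure M (E \<inter> B) = \<nu> (True # s) B)" for D s E
  \<comment> \<open>The choice is made before a \<open>good\<close> set is known to exist: existence
    at \<open>s\<close> requires \<open>K s\<close> to carry \<open>\<nu> s\<close>, which the
    induction in \<open>Ks\<close> supplies level by level.\<close>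
  define K where "K = rec_list (space M) (\<lambda>b s D. if b then (SOME E. good D s E) else D - (SOME E. good D s E))"
  have K: "K [] = space M" "K (True # s) = (SOME E. good (K s) s E)" "K (False # s) = K s - K (True # s)" for s
    by (simp_all add: K_def)
  have exK: "K s \<in> sets M \<and> (\<forall>B\<in>sets N. measure M (K s \<inter> B) = \<nu> s B) \<Longrightarrow> good (K s) s (K (True # s))" for s
  proof -
    assume h: "K s \<in> sets M \<and> (\<forall>B\<in>sets N. measure M (K s \<inter> B) = \<nu> s B)"
    have "\<nu> (True # s) B \<le> measure M (K s \<inter> B)" if "B \<in> sets N" for B
      using h split[OF that, of s] dominated_chargeD(1)[OF charge that, of "False # s"] that by simp
    then obtain E where "E \<in> sets M" "E \<subseteq> K s" "\<And>B. B \<in> sets N \<Longrightarrow> measure M (E \<inter> B) = \<nu> (True # s) B"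
      using conditional_Lyapunov[OF _ charge[of "True # s"]] h by blast
    then have "\<exists>E. good (K s) s E" unfolding good_def by blast
    then show ?thesis unfolding K(2) by (rule someI_ex)
  qed
  have Ks: "K s \<in> sets M \<and> (\<forall>B\<in>sets N. measure M (K s \<inter> B) = \<nu> s B)" for s
  proof (induction s)
    case Nil
    have "\<nu> [] B = measure M (space M \<inter> B)" if "B \<in> sets N" for B
      using \<nu>[OF that, of "[]"] by (simp add: LIMSEQ_const_iff)
    then show ?case by (simp add: K(1))
  next
    case (Cons b s)
    have T: "K (True # s) \<in> sets M" "K (True # s) \<subseteq> K s" "\<And>B. B \<in> sets N \<Longrightarrow> measure M (K (True # s) \<inter> B) = \<nu> (True # s) B"
      using exK[OF Cons.IH] by (auto simp: good_def)
    show ?case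
    proof (cases b)
      case True
      then show ?thesis using T by auto
    next
      case False
      have "measure M (K (False # s) \<inter> B) = \<nu> (False # s) B" if B: "B \<in> sets N" for B
      proof -
        have "K (False # s) \<inter> B = K s \<inter> B - K (True # s) \<inter> B" by (auto simp: K(3))
        also have "measure M \<dots> = measure M (K s \<inter> B) - measure M (K (True # s) \<inter> B)"
          using T Cons.IH sets_sub[OF B] by (intro finite_measure_Diff) auto
        finally show ?thesis using T(3)[OF B] Cons.IH B split[OF B, of s] by simp
      qed
      then show ?thesis using False T(1) Cons.IH by (auto simp: K(3))
    qed
  qed
  have sub: "K (True # s) \<subseteq> K s" for s using exK[OF Ks] by (simp add: good_def)
  define A' where "A' j = (\<Union>s\<in>{s. length s = j}. K (True # s))" for j
  have fin: "finite {s :: bool list. length s = j}" for j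
    using finite_lists_length_eq[of "UNIV :: bool set" j] by simp
  have cellK: "cell (space M) A' s = K s" for s
    using binary_tree_eq_cell[of K "space M" s] K sub unfolding A'_def by blast
  show ?thesis
  proof (rule that)
    show "A' j \<in> sets M" for j unfolding A'_def using fin Ks by (intro sets.finite_UN) auto
    show "(\<lambda>n. measure M (cell (space M) (A n) s \<inter> B)) \<longlonglongrightarrow> measure M (cell (space M) A' s \<inter> B)"
      if "B \<in> sets N" for s B
      using \<nu>[OF that, of s] Ks[of s] that by (simp add: cellK)
  qed
qed

text \<open>Measures of events depending on finitely many of the sets are finite sums of cell
  measures, so convergence of the latter suffices. The arbitrary \<open>P\<close> lets every Boolean
  condition on the sets \<open>A n j\<close> be passed to the limit by one statement.\<close>

lemma joint_limit_realization:
  fixes A :: "nat \<Rightarrow> nat \<Rightarrow> 'a set"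
  assumes gen: "countably_generated N" and A: "\<And>n j. A n j \<in> sets M"
  shows "\<exists>r A'. strict_mono (r :: nat \<Rightarrow> nat) \<and> (\<forall>j. A' j \<in> sets M) \<and>
    (\<forall>J P B. finite J \<longrightarrow> B \<in> sets N \<longrightarrow>
       (\<lambda>n. measure M {t\<in>B. P (\<lambda>j. j \<in> J \<and> t \<in> A (r n) j)}) \<longlonglongrightarrow> measure M {t\<in>B. P (\<lambda>j. j \<in> J \<and> t \<in> A' j)})"
proof -
  obtain r :: "nat \<Rightarrow> nat" where r: "strict_mono r"
    and conv: "\<And>s B. B \<in> sets N \<Longrightarrow> convergent (\<lambda>n. measure M (cell (space M) (A (r n)) s \<inter> B))"
    using convergent_measure_inter_subseq[OF gen, of "\<lambda>s n. cell (space M) (A n) s"] sets_cell A by blast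
  obtain A' where A': "\<And>j. A' j \<in> sets M"
    and lim: "\<And>s B. B \<in> sets N \<Longrightarrow>
      (\<lambda>n. measure M (cell (space M) (A (r n)) s \<inter> B)) \<longlonglongrightarrow> measure M (cell (space M) A' s \<inter> B)"
    using realize_limits[of "\<lambda>n. A (r n)"] A conv by blast
  show ?thesis
  proof (intro exI conjI allI impI)
    show "strict_mono r" "\<And>j. A' j \<in> sets M" by (fact r A')+
    fix J :: "nat set" and P :: "(nat \<Rightarrow> bool) \<Rightarrow> bool" and B assume J: "finite J" and B: "B \<in> sets N"
    obtain m P' where P'_all: "\<forall>S. P (\<lambda>j. j \<in> J \<and> S j) = P' (\<lambda>j. j < m \<and> S j)"
      using event_initial_segment[where P = P, OF J] by (elim exE)
    note P' = P'_all[rule_format]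
    show "(\<lambda>n. measure M {t\<in>B. P (\<lambda>j. j \<in> J \<and> t \<in> A (r n) j)}) \<longlonglongrightarrow> measure M {t\<in>B. P (\<lambda>j. j \<in> J \<and> t \<in> A' j)}"
      unfolding P' measure_event_eq_sum_cell(2)[where P=P' and m=m, OF A sets_sub[OF B]] measure_event_eq_sum_cell(2)[where P=P' and m=m, OF A' sets_sub[OF B]]
      using lim[OF B] by (intro tendsto_sum)
  qed
qed

end

section \<open>Measurable correspondences and selections\<close>

lemma dense_sequence_exists:
  obtains d :: "nat \<Rightarrow> 'x::{metric_space, second_countable_topology}"
  where "\<And>x e. 0 < e \<Longrightarrow> \<exists>i. dist (d i) x < e"
proof -
  obtain D :: "'x set" where D: "countable D" "\<And>X. open X \<Longrightarrow> X \<noteq> {} \<Longrightarrow> \<exists>d\<in>D. d \<in> X"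
    using countable_dense_exists by blast
  then have ne: "D \<noteq> {}" using D(2)[of UNIV] by auto
  show ?thesis
  proof (rule that[of "from_nat_into D"])
    fix x :: 'x and e :: real assume "0 < e"
    then obtain y where "y \<in> D" "y \<in> ball x e" using D(2)[of "ball x e"] by auto
    then show "\<exists>i. dist (from_nat_into D i) x < e"
      using from_nat_into_surj[OF D(1)] by (metis dist_commute mem_ball)
  qed
qed

lemma measurable_correspondence_nonempty:
  "measurable_correspondence N F \<Longrightarrow> t \<in> space N \<Longrightarrow> F t \<noteq> {}"
  by (auto simp: measurable_correspondence_def correspondence_def)

text \<open>An open set in a metric space is a countable union of closed sets, and meeting a union
  means meeting one of its members.\<close>

lemma measurable_correspondence_open:
  fixes F :: "'a \<Rightarrow> 'x::metric_space set"
  assumes F: "measurable_correspondence N F" and U: "open U"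
  shows "{t \<in> space N. F t \<inter> U \<noteq> {}} \<in> sets N"
proof -
  have "fsigma_in euclidean U"
    using U by (intro open_imp_fsigma_in metrizable_space_euclidean) auto
  then obtain \<U> where \<U>: "countable \<U>" "\<And>E. E \<in> \<U> \<Longrightarrow> closed E" "\<Union>\<U> = U"
    by (auto simp: fsigma_in_def union_of_def subset_iff)
  have "{t \<in> space N. F t \<inter> U \<noteq> {}} = (\<Union>E\<in>\<U>. {t \<in> space N. F t \<inter> E \<noteq> {}})"
    unfolding \<U>(3)[symmetric] by blast
  also have "\<dots> \<in> sets N"
    using F \<U> by (intro sets.countable_UN') (auto simp: measurable_correspondence_def)
  finally show ?thesis .
qed

lemma measurable_correspondence_UN:
  assumes "\<And>n::nat. measurable_correspondence N (F n)" "I \<noteq> {}"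
  shows "measurable_correspondence N (\<lambda>t. \<Union>n\<in>I. F n t)"
  unfolding measurable_correspondence_def
proof (intro conjI allI impI)
  show "correspondence (space N) (\<lambda>t. \<Union>n\<in>I. F n t)"
    using assms by (auto simp: measurable_correspondence_def correspondence_def)
  fix E :: "'b set" assume "closed E"
  then have "(\<Union>n\<in>I. {t \<in> space N. F n t \<inter> E \<noteq> {}}) \<in> sets N"
    using assms by (intro sets.countable_UN') (auto simp: measurable_correspondence_def)
  also have "(\<Union>n\<in>I. {t \<in> space N. F n t \<inter> E \<noteq> {}}) = {t \<in> space N. (\<Union>n\<in>I. F n t) \<inter> E \<noteq> {}}"
    by blast
  finally show "{t \<in> space N. (\<Union>n\<in>I. F n t) \<inter> E \<noteq> {}} \<in> sets N" .
qed

text \<open>The Kuratowski-Ryll-Nardzewski construction: for radii \<open>(1/2)^n\<close>, pick the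
  first ball that meets \<open>F t\<close> inside the ball picked before. The centres converge
  geometrically. As \<open>F t\<close> need not be closed, the limit is located in the
  closure.\<close>

lemma measurable_selection_exists:
  fixes F :: "'a \<Rightarrow> 'x::{banach, second_countable_topology} set"
  assumes F: "measurable_correspondence N F"
  shows "\<exists>f\<in>borel_measurable N. \<forall>t\<in>space N. f t \<in> closure (F t)"
proof -
  obtain d :: "nat \<Rightarrow> 'x" where d: "\<And>x e. 0 < e \<Longrightarrow> \<exists>i. dist (d i) x < e"
    using dense_sequence_exists by blast
  define U where "U i n = ball (d i) ((1/2)^n)" for i n
  have oU: "open (U i n)" for i n by (simp add: U_def)
  define idx where "idx = rec_nat (\<lambda>t. LEAST i. F t \<inter> U i 0 \<noteq> {})
    (\<lambda>n k t. LEAST i. F t \<inter> (U i (Suc n) \<inter> U (k t) n) \<noteq> {})"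
  have idx: "idx 0 = (\<lambda>t. LEAST i. F t \<inter> U i 0 \<noteq> {})"
    "idx (Suc n) = (\<lambda>t. LEAST i. F t \<inter> (U i (Suc n) \<inter> U (idx n t) n) \<noteq> {})" for n
    by (simp_all add: idx_def)
  have [measurable]: "Measurable.pred N (\<lambda>t. F t \<inter> W \<noteq> {})" if "open W" for W
    unfolding pred_def using measurable_correspondence_open[OF F that] .
  have idx_meas [measurable]: "idx n \<in> measurable N (count_space UNIV)" for n
  proof (induction n)
    case 0
    show ?case unfolding idx using oU by measurable
  next
    case (Suc n)
    note Suc.IH [measurable]
    \<comment> \<open>The open set on the left depends on \<open>t\<close>. Splitting by the
      countably many values of \<open>idx n t\<close> leaves fixed open sets, for which
      measurability is known.\<close>
    have eq: "(F t \<inter> (U i (Suc n) \<inter> U (idx n t) n) \<noteq> {}) \<longleftrightarrow>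
      (\<exists>j. idx n t = j \<and> F t \<inter> (U i (Suc n) \<inter> U j n) \<noteq> {})" for t i by blast
    have "open (U i (Suc n) \<inter> U j n)" for i j using oU by auto
    then show ?case unfolding idx(2) eq by measurable
  qed
  have hit0: "\<exists>i. x \<in> U i n" for x n
    using d[of "(1/2)^n" x] by (auto simp: U_def)
  have step: "F t \<inter> (U (idx (Suc n) t) (Suc n) \<inter> U (idx n t) n) \<noteq> {}" if "F t \<inter> U (idx n t) n \<noteq> {}" for n t
  proof -
    obtain x where x: "x \<in> F t" "x \<in> U (idx n t) n" using \<open>F t \<inter> U (idx n t) n \<noteq> {}\<close> by blast
    obtain i where "x \<in> U i (Suc n)" using hit0 by blast
    then have "F t \<inter> (U i (Suc n) \<inter> U (idx n t) n) \<noteq> {}" using x by blast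
    then show ?thesis unfolding idx(2) by (rule LeastI)
  qed
  have hit: "F t \<inter> U (idx n t) n \<noteq> {}" if t: "t \<in> space N" for n t
  proof (induction n)
    case 0
    obtain x where x: "x \<in> F t" using measurable_correspondence_nonempty[OF F t] by blast
    obtain i where "x \<in> U i 0" using hit0 by blast
    then have "F t \<inter> U i 0 \<noteq> {}" using x by blast
    then show ?case unfolding idx(1) by (rule LeastI)
  next
    case (Suc n)
    show ?case using step[OF Suc.IH] by blast
  qed
  define f where "f t = lim (\<lambda>n. d (idx n t))" for t
  show ?thesis
  proof (intro bexI ballI)
    show "f \<in> borel_measurable N" unfolding f_def by measurable
    fix t assume t: "t \<in> space N"
    have step_le: "norm (d (idx (Suc n) t) - d (idx n t)) \<le> 2 * (1/2)^n" for n
    proof -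
      obtain x where "x \<in> U (idx (Suc n) t) (Suc n)" "x \<in> U (idx n t) n"
        using step[OF hit[OF t]] by blast
      then have "dist (d (idx (Suc n) t)) (d (idx n t)) < (1/2)^Suc n + (1/2)^n"
        unfolding U_def mem_ball using dist_triangle_less_add dist_commute by metis
      moreover have "(1/2::real)^Suc n \<le> (1/2)^n" by simp
      ultimately show ?thesis unfolding dist_norm by linarith
    qed
    have "summable (\<lambda>n. d (idx (Suc n) t) - d (idx n t))"
      by (rule summable_comparison_test'[of "\<lambda>n. 2 * (1/2)^n" 0, OF _ step_le]) auto
    then have "convergent (\<lambda>n. \<Sum>k<n. d (idx (Suc k) t) - d (idx k t))"
      by (simp add: summable_iff_convergent)
    then have "convergent (\<lambda>n. d (idx n t) - d (idx 0 t))"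
      by (simp only: sum_lessThan_telescope[of "\<lambda>k. d (idx k t)"])
    then have "convergent (\<lambda>n. d (idx n t) - d (idx 0 t) + d (idx 0 t))"
      by (intro convergent_add convergent_const)
    then have lim: "(\<lambda>n. d (idx n t)) \<longlonglongrightarrow> f t"
      by (simp add: f_def convergent_LIMSEQ_iff)
    show "f t \<in> closure (F t)"
      unfolding closure_approachable
    proof (intro allI impI)
      fix e :: real assume e: "0 < e"
      have "(\<lambda>n. dist (d (idx n t)) (f t) + (1/2)^n) \<longlonglongrightarrow> 0"
        using tendsto_add[OF tendsto_dist[OF lim tendsto_const[of "f t"]] LIMSEQ_power_zero[of "1/2::real"]] by simp
      then have "eventually (\<lambda>n. dist (d (idx n t)) (f t) + (1/2)^n < e) sequentially"
        using e by (rule order_tendstoD)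
      then obtain n where n: "dist (d (idx n t)) (f t) + (1/2)^n < e"
        by (auto simp: eventually_sequentially)
      obtain x where "x \<in> F t" "dist (d (idx n t)) x < (1/2)^n"
        using hit[OF t, of n] by (auto simp: U_def)
      then show "\<exists>y\<in>F t. dist y (f t) < e"
        using n dist_triangle2[of x "f t" "d (idx n t)"] dist_commute[of x "d (idx n t)"] dist_commute[of "f t" "d (idx n t)"]
        by (intro bexI[of _ x]) auto
    qed
  qed
qed

section \<open>Limits of shrinking balls and approximation of integrals\<close>

text \<open>Two balls that meet have centres no further apart than the sum of their radii. Hence any
  choice of one ball per radius gives a Cauchy sequence, and every ball of the family lies close to
  its limit. Taking the least index keeps the choice measurable when \<open>D\<close> depends on a
  point.\<close>

lemma ball_family_limit:
  fixes d :: "nat \<Rightarrow> 'x::complete_space"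
  assumes ex: "\<And>m. \<exists>i. D i m"
    and meet: "\<And>i m i' m'. D i m \<Longrightarrow> D i' m' \<Longrightarrow> ball (d i) ((1/2)^m) \<inter> ball (d i') ((1/2)^m') \<noteq> {}"
    and "D i m"
  shows "dist (d i) (lim (\<lambda>m. d (LEAST i. D i m))) \<le> (1/2)^m"
proof -
  define x where "x m = d (LEAST i. D i m)" for m
  have near: "dist (d i) (x n) \<le> (1/2)^m + (1/2)^n" if "D i m" for i m n
  proof -
    have "D (LEAST i. D i n) n" using ex[of n] by (rule LeastI_ex)
    then obtain y where "dist (d i) y < (1/2)^m" "dist (x n) y < (1/2)^n"
      using meet[OF \<open>D i m\<close>] by (fastforce simp: x_def)
    then show ?thesis using dist_triangle2[of "d i" "x n" y] by linarith
  qed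
  have half: "(\<lambda>n. (1/2::real)^n) \<longlonglongrightarrow> 0" by (rule LIMSEQ_power_zero) simp
  have "Cauchy x"
  proof (rule metric_CauchyI)
    fix e :: real assume "0 < e"
    then have "eventually (\<lambda>n. (1/2::real)^n < e / 2) sequentially"
      using half by (intro order_tendstoD) auto
    then obtain k where k: "\<And>n. k \<le> n \<Longrightarrow> (1/2::real)^n < e / 2" by (auto simp: eventually_sequentially)
    show "\<exists>k. \<forall>m\<ge>k. \<forall>n\<ge>k. dist (x m) (x n) < e"
    proof (intro exI allI impI)
      fix m n assume mn: "k \<le> m" "k \<le> n"
      have "D (LEAST i. D i m) m" using ex[of m] by (rule LeastI_ex)
      then show "dist (x m) (x n) < e"
        using near[of "LEAST i. D i m" m n] k[OF mn(1)] k[OF mn(2)] by (simp add: x_def)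
    qed
  qed
  then have lim: "x \<longlonglongrightarrow> lim x" using Cauchy_convergent convergent_LIMSEQ_iff by blast
  have "(\<lambda>n. dist (d i) (x n)) \<longlonglongrightarrow> dist (d i) (lim x)"
    using lim by (intro tendsto_dist tendsto_const)
  moreover have "(\<lambda>n. (1/2)^m + (1/2)^n) \<longlonglongrightarrow> (1/2::real)^m + 0"
    using half by (intro tendsto_add tendsto_const)
  ultimately have "dist (d i) (lim x) \<le> (1/2)^m + 0"
    using near[OF \<open>D i m\<close>] by (intro LIMSEQ_le) auto
  then show "dist (d i) (lim (\<lambda>m. d (LEAST i. D i m))) \<le> (1/2)^m"
    by (simp add: x_def[abs_def])
qed

text \<open>Approximate \<open>f\<close> by the centre \<open>d i\<close> of the first set
  \<open>E i\<close> with \<open>i < k\<close> containing the point, and by 0 if there is none. The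
  error is at most \<open>\<rho>\<close> in the first case and at most \<open>h\<close> in the
  second, which occurs almost surely outside \<open>K\<close>. The bound does not mention
  \<open>f\<close> or \<open>E\<close>, so it can serve a whole sequence and its limit at
  once.\<close>

lemma (in finite_measure) integral_near_simple:
  fixes f :: "'a \<Rightarrow> 'x::{banach, second_countable_topology}"
  assumes f: "f \<in> borel_measurable M" "AE t in M. norm (f t) \<le> h t" "integrable M h"
    and E: "\<And>i. E i \<in> sets M" "AE t in M. \<forall>i. t \<in> E i \<longrightarrow> dist (d i) (f t) \<le> \<rho>"
    and K: "K \<in> sets M" "AE t in M. t \<in> K \<longrightarrow> (\<exists>i<k. t \<in> E i)"
    and \<rho>: "0 \<le> \<rho>"
  shows "norm (integral\<^sup>L M f - (\<Sum>i<k. measure M (disjointed E i) *\<^sub>R d i))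
    \<le> \<rho> * measure M (space M) + (\<integral>t. indicator (space M - K) t * h t \<partial>M)"
proof -
  define s where "s t = (\<Sum>i<k. indicator (disjointed E i) t *\<^sub>R d i)" for t
  have dE: "disjointed E i \<in> sets M" for i using E(1) by (auto simp: disjointed_def)
  have is_f: "integrable M f"
    by (rule Bochner_Integration.integrable_bound[OF f(3) f(1)]) (use f(2) in auto)
  have "integrable M (indicat_real (disjointed E i))" for i
    using dE by (intro integrable_real_indicator) (auto simp: emeasure_eq_measure)
  then have is_d: "integrable M (\<lambda>t. indicat_real (disjointed E i) t *\<^sub>R d i)"
    and int_d: "(\<integral>t. indicat_real (disjointed E i) t *\<^sub>R d i \<partial>M) = measure M (disjointed E i) *\<^sub>R d i" for i
    using sets.sets_into_space[OF dE] by (auto simp: Int_absorb2)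
  have is_s: "integrable M s" unfolding s_def using is_d by (rule Bochner_Integration.integrable_sum)
  have int_s: "integral\<^sup>L M s = (\<Sum>i<k. measure M (disjointed E i) *\<^sub>R d i)"
    unfolding s_def using is_d int_d by (subst Bochner_Integration.integral_sum) auto
  have ind: "integrable M (\<lambda>t. indicator (space M - K) t * h t)"
    using integrable_mult_indicator[OF _ f(3), of "space M - K"] K by simp
  have "AE t in M. norm (f t - s t) \<le> \<rho> + indicator (space M - K) t * h t"
    using f(2) E(2) K(2) AE_space
  proof eventually_elim
    case (elim t)
    have h: "0 \<le> h t" using elim(1) norm_ge_zero[of "f t"] by linarith
    show ?case
    proof (cases "\<exists>i<k. t \<in> E i")
      case True
      define j where "j = (LEAST i. t \<in> E i)"
      obtain i0 where "i0 < k" "t \<in> E i0" using True by blast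
      then have j: "t \<in> E j" "j < k" "\<And>i. i < j \<Longrightarrow> t \<notin> E i"
        unfolding j_def using LeastI[of "\<lambda>i. t \<in> E i"] Least_le[of "\<lambda>i. t \<in> E i" i0] not_less_Least by auto
      have "indicator (disjointed E i) t = (if i = j then 1 else (0::real))" for i
      proof -
        have "t \<in> disjointed E i \<longleftrightarrow> i = j"
          using j unfolding disjointed_def by (cases i j rule: linorder_cases) auto
        then show ?thesis by (simp add: indicator_def)
      qed
      then have "s t = (\<Sum>i<k. (if i = j then d i else 0))"
        unfolding s_def by (intro sum.cong) auto
      also have "\<dots> = d j" using j by (simp add: sum.delta)
      finally have "norm (f t - s t) \<le> \<rho>" using elim(2) j(1) by (simp add: dist_norm norm_minus_commute)
      then show ?thesis using h by (simp add: indicator_def)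
    next
      case False
      then have "t \<notin> disjointed E i" if "i < k" for i using that by (auto simp: disjointed_def)
      then have "s t = 0" by (simp add: s_def)
      moreover have "t \<in> space M - K" using False elim by blast
      ultimately show ?thesis using elim(1) \<rho> by simp
    qed
  qed
  then have "(\<integral>t. norm (f t - s t) \<partial>M) \<le> (\<integral>t. \<rho> + indicator (space M - K) t * h t \<partial>M)"
    using is_f is_s ind by (intro integral_mono_AE) auto
  then have "norm (integral\<^sup>L M (\<lambda>t. f t - s t)) \<le> (\<integral>t. \<rho> + indicator (space M - K) t * h t \<partial>M)"
    using integral_norm_bound[of M "\<lambda>t. f t - s t"] by linarith
  also have "\<dots> = \<rho> * measure M (space M) + (\<integral>t. indicator (space M - K) t * h t \<partial>M)"
    using ind by (subst Bochner_Integration.integral_add) (auto simp: mult.commute)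
  finally show ?thesis using is_f is_s by (simp add: int_s)
qed

section \<open>The limit selection\<close>

context nowhere_equivalent_subalg
begin

text \<open>This is the compactness result behind both claims. The constraints \<open>C\<close> are
  quantified after \<open>g\<close>, so one limit can be tested against countably many of them; the
  index \<open>k\<close> admits constraints that hold only from some term on.\<close>

lemma limit_selection:
  fixes f :: "nat \<Rightarrow> 'a \<Rightarrow> 'x::{banach, second_countable_topology}"
  assumes gen: "countably_generated N"
    and G: "measurable_correspondence N G" "integrably_bounded M G" "AE t in M. compact (G t)"
    and f: "\<And>n. f n \<in> borel_measurable M" "\<And>n. AE t in M. f n t \<in> G t"
  shows "\<exists>r g. strict_mono (r :: nat \<Rightarrow> nat) \<and> g \<in> borel_measurable M \<and> integrable M g \<and>
    (\<lambda>n. integral\<^sup>L M (f (r n))) \<longlonglongrightarrow> integral\<^sup>L M g \<and>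
    (\<forall>C k. measurable_correspondence N C \<longrightarrow> (\<forall>n\<ge>k. AE t in M. f n t \<in> C t) \<longrightarrow>
       (AE t in M. g t \<in> closure (C t)))"
proof -
  obtain h where h: "integrable M h" "AE t in M. \<forall>x\<in>G t. norm x \<le> h t"
    using G(2) by (auto simp: integrably_bounded_def)
  obtain d :: "nat \<Rightarrow> 'x" where d: "\<And>x e. 0 < e \<Longrightarrow> \<exists>i. dist (d i) x < e"
    using dense_sequence_exists by blast
  define U where "U i m = ball (d i) ((1/2)^m)" for i m
  have oU: "open (U i m)" for i m by (simp add: U_def)
  have cover: "\<exists>i. x \<in> U i m" for x m using d[of "(1/2)^m" x] by (auto simp: U_def)
  define enc where "enc i m = prod_encode (i, m)" for i m
  define A where "A n j = {t \<in> space M. f n t \<in> U (fst (prod_decode j)) (snd (prod_decode j))}" for n j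
  have A: "A n j \<in> sets M" for n j
  proof -
    have [measurable]: "f n \<in> borel_measurable M" "U i m \<in> sets borel" for i m using f(1) oU by auto
    show ?thesis unfolding A_def by measurable
  qed
  have A_enc: "t \<in> A n (enc i m) \<longleftrightarrow> t \<in> space M \<and> f n t \<in> U i m" for t n i m
    by (simp add: A_def enc_def)
  obtain r A' where r: "strict_mono (r :: nat \<Rightarrow> nat)" and A'_all: "\<forall>j. A' j \<in> sets M"
    and lim_all: "\<forall>J P B. finite J \<longrightarrow> B \<in> sets N \<longrightarrow>
       (\<lambda>n. measure M {t\<in>B. P (\<lambda>j. j \<in> J \<and> t \<in> A (r n) j)}) \<longlonglongrightarrow> measure M {t\<in>B. P (\<lambda>j. j \<in> J \<and> t \<in> A' j)}"
    using joint_limit_realization[of A, OF gen A] by (elim exE conjE)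
  note A' = A'_all[rule_format] and lim = lim_all[rule_format]
  have rk: "n \<le> r n" for n using r by (rule seq_suble)
  define E where "E i m = A' (enc i m)" for i m
  have E: "E i m \<in> sets M" for i m using A' by (simp add: E_def)
  \<comment> \<open>Transfer principle: a finite Boolean condition that almost surely fails on
    \<open>B\<close> for all late \<open>n\<close> also fails for the limit sets, since its measure
    is a limit of zeros.\<close>
  have never: "AE t in M. t \<in> B \<longrightarrow> \<not> P (\<lambda>j. j \<in> J \<and> t \<in> A' j)"
    if J: "finite J" and B: "B \<in> sets N"
      and ae: "\<And>n. k \<le> n \<Longrightarrow> AE t in M. t \<in> B \<longrightarrow> \<not> P (\<lambda>j. j \<in> J \<and> t \<in> A n j)"
    for J P B and k :: nat
  proof -
    have zero: "measure M {t\<in>B. P (\<lambda>j. j \<in> J \<and> t \<in> A (r n) j)} = 0" if "k \<le> n" for n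
    proof -
      have "k \<le> r n" using that rk[of n] by linarith
      then have "AE t in M. t \<notin> {t\<in>B. P (\<lambda>j. j \<in> J \<and> t \<in> A (r n) j)}"
        using ae[of "r n"] by auto
      then have "{t\<in>B. P (\<lambda>j. j \<in> J \<and> t \<in> A (r n) j)} \<in> null_sets M"
        using sets_finite_event[where P = P and A = "A (r n)", OF A sets_sub[OF B] J] by (simp add: AE_iff_null_sets)
      then show ?thesis by (rule measure_eq_0_null_sets)
    qed
    have "(\<lambda>n. measure M {t\<in>B. P (\<lambda>j. j \<in> J \<and> t \<in> A (r n) j)}) \<longlonglongrightarrow> 0"
      using zero by (intro tendsto_eventually) (auto simp: eventually_sequentially)
    then have "measure M {t\<in>B. P (\<lambda>j. j \<in> J \<and> t \<in> A' j)} = 0"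
      using lim[OF J B] LIMSEQ_unique by blast
    then have "{t\<in>B. P (\<lambda>j. j \<in> J \<and> t \<in> A' j)} \<in> null_sets M"
      using sets_finite_event[where P = P and A = A', OF A' sets_sub[OF B] J] by (intro null_setsI) (simp_all add: emeasure_eq_measure)
    then have "AE t in M. t \<notin> {t\<in>B. P (\<lambda>j. j \<in> J \<and> t \<in> A' j)}" by (rule AE_not_in)
    then show ?thesis by eventually_elim auto
  qed
  have top: "space M \<in> sets N" using sets.top[of N] by simp
  have meet: "AE t in M. \<forall>i m i' m'. t \<in> E i m \<longrightarrow> t \<in> E i' m' \<longrightarrow> U i m \<inter> U i' m' \<noteq> {}"
  proof -
    have "AE t in M. t \<in> E i m \<longrightarrow> t \<in> E i' m' \<longrightarrow> U i m \<inter> U i' m' \<noteq> {}" for i m i' m'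
    proof (cases "U i m \<inter> U i' m' = {}")
      case True
      have "AE t in M. t \<in> space M \<longrightarrow> \<not> (t \<in> A n (enc i m) \<and> t \<in> A n (enc i' m'))" for n
        using True by (intro AE_I2) (auto simp: A_enc)
      then have "AE t in M. t \<in> space M \<longrightarrow> \<not> (t \<in> A' (enc i m) \<and> t \<in> A' (enc i' m'))"
        using never[OF _ top, where k = 0 and J = "{enc i m, enc i' m'}" and P = "\<lambda>S. S (enc i m) \<and> S (enc i' m')"]
        by simp
      with AE_space show ?thesis by eventually_elim (auto simp: E_def)
    qed auto
    then show ?thesis unfolding AE_all_countable by (intro allI)
  qed
  \<comment> \<open>On the set \<open>B\<close> of \<open>N\<close> where \<open>C t\<close> misses
    the ball, \<open>f n\<close> almost surely stays outside the ball for \<open>n \<ge> k\<close>;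
    the transfer principle carries this over to \<open>E i m\<close>.\<close>
  have hits: "AE t in M. \<forall>i m. t \<in> E i m \<longrightarrow> C t \<inter> U i m \<noteq> {}"
    if C: "measurable_correspondence N C" and fC: "\<And>n. k \<le> n \<Longrightarrow> AE t in M. f n t \<in> C t"
    for C k
  proof -
    have "AE t in M. t \<in> E i m \<longrightarrow> C t \<inter> U i m \<noteq> {}" for i m
    proof -
      define B where "B = space N - {t \<in> space N. C t \<inter> U i m \<noteq> {}}"
      have B: "B \<in> sets N"
        unfolding B_def by (rule sets.compl_sets[OF measurable_correspondence_open[OF C oU]])
      have "AE t in M. t \<in> B \<longrightarrow> t \<notin> A n (enc i m)" if "k \<le> n" for n
        using fC[OF that] by eventually_elim (auto simp: A_enc B_def)
      then have "AE t in M. t \<in> B \<longrightarrow> t \<notin> A' (enc i m)"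
        using never[OF _ B, where k = k and J = "{enc i m}" and P = "\<lambda>S. S (enc i m)"] by simp
      with AE_space show ?thesis by eventually_elim (auto simp: E_def B_def)
    qed
    then show ?thesis unfolding AE_all_countable by (intro allI)
  qed
  \<comment> \<open>The points \<open>t\<close> at which the first \<open>k\<close> balls of radius
    \<open>(1/2)^m\<close> cover \<open>G t\<close>. The uncovered part is a closed set to be hit by
    \<open>G t\<close>, whence \<open>K k m\<close> belongs to \<open>N\<close>; compactness of
    \<open>G t\<close> makes these sets exhaust the space as \<open>k\<close> grows.\<close>
  define K where "K k m = space N - {t \<in> space N. G t \<inter> (- (\<Union>i<k. U i m)) \<noteq> {}}" for k m
  have KN: "K k m \<in> sets N" for k m
  proof -
    have "closed (- (\<Union>i<k. U i m))" using oU by (intro closed_Compl open_UN) auto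
    then have "{t \<in> space N. G t \<inter> (- (\<Union>i<k. U i m)) \<noteq> {}} \<in> sets N"
      using G(1) unfolding measurable_correspondence_def by blast
    then show ?thesis unfolding K_def by (rule sets.compl_sets)
  qed
  have K: "K k m \<in> sets M" for k m using KN sets_sub by blast
  have K_cover: "t \<in> K k m \<Longrightarrow> x \<in> G t \<Longrightarrow> \<exists>i<k. x \<in> U i m" for t k m x
    by (auto simp: K_def)
  have K_mono: "t \<in> K k m \<Longrightarrow> k \<le> k' \<Longrightarrow> t \<in> K k' m" for t k k' m
    by (fastforce simp: K_def)
  have K_exhausts: "AE t in M. \<forall>m. \<exists>k. t \<in> K k m"
    using G(3) AE_space
  proof eventually_elim
    case (elim t)
    show ?case
    proof
      fix m
      obtain I where I: "finite I" "G t \<subseteq> (\<Union>i\<in>I. U i m)"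
        using compactE_image[OF elim(1), of UNIV "\<lambda>i. U i m"] oU cover by (metis UN_I UNIV_I subsetI)
      then obtain k where "I \<subseteq> {..<k}" unfolding finite_nat_iff_bounded by (elim exE conjE)
      then have "t \<in> K k m" using I elim(2) by (auto simp: K_def)
      then show "\<exists>k. t \<in> K k m" ..
    qed
  qed
  \<comment> \<open>Here no mass is lost: on \<open>K k m\<close> each \<open>f n\<close> falls into
    one of the first \<open>k\<close> balls. That is a condition on finitely many events, so it
    passes to the limit.\<close>
  have K_E: "AE t in M. \<forall>k m. t \<in> K k m \<longrightarrow> (\<exists>i<k. t \<in> E i m)"
  proof -
    have "AE t in M. t \<in> K k m \<longrightarrow> (\<exists>i<k. t \<in> E i m)" for k m
    proof -
      let ?J = "(\<lambda>i. enc i m) ` {..<k}"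
      have "AE t in M. t \<in> K k m \<longrightarrow> \<not> (\<forall>i<k. \<not> (enc i m \<in> ?J \<and> t \<in> A n (enc i m)))" for n
        using f(2)[of n] AE_space by eventually_elim (auto simp: A_enc dest: K_cover)
      then have "AE t in M. t \<in> K k m \<longrightarrow> \<not> (\<forall>i<k. \<not> (enc i m \<in> ?J \<and> t \<in> A' (enc i m)))"
        by (intro never[OF _ KN, where k = 0 and J = ?J and P = "\<lambda>S. \<forall>i<k. \<not> S (enc i m)"]) simp_all
      then show ?thesis by eventually_elim (auto simp: E_def)
    qed
    then show ?thesis unfolding AE_all_countable by (intro allI)
  qed
  have E_ex: "AE t in M. \<forall>m. \<exists>i. t \<in> E i m"
    using K_exhausts K_E by eventually_elim blast

  define g where "g t = lim (\<lambda>m. d (LEAST i. t \<in> E i m))" for t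
  have g_meas: "g \<in> borel_measurable M"
  proof -
    note E [measurable]
    have [measurable]: "(\<lambda>t. LEAST i. t \<in> E i m) \<in> measurable M (count_space UNIV)" for m
      by measurable
    show ?thesis unfolding g_def by measurable
  qed
  have g_near: "AE t in M. \<forall>i m. t \<in> E i m \<longrightarrow> dist (d i) (g t) \<le> (1/2)^m"
    using E_ex meet unfolding g_def U_def
  proof eventually_elim
    case (elim t)
    then show ?case using ball_family_limit[of "\<lambda>i m. t \<in> E i m" d] by blast
  qed
  have g_closure: "AE t in M. g t \<in> closure (C t)"
    if C: "measurable_correspondence N C" and fC: "\<And>n. k \<le> n \<Longrightarrow> AE t in M. f n t \<in> C t"
    for C k
  proof -
    have "AE t in M. \<forall>i m. t \<in> E i m \<longrightarrow> C t \<inter> U i m \<noteq> {}" using C fC by (rule hits)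
    with E_ex g_near show ?thesis
    proof eventually_elim
      case (elim t)
      show ?case unfolding closure_approachable
      proof (intro allI impI)
        fix e :: real assume e: "0 < e"
        then obtain m where m: "(1/2::real)^m < e / 2" using real_arch_pow_inv[of "e / 2" "1/2"] by auto
        obtain i where i: "t \<in> E i m" using elim by blast
        then obtain y where y: "y \<in> C t" "dist (d i) y < (1/2)^m" using elim(3) by (fastforce simp: U_def)
        moreover have "dist (d i) (g t) \<le> (1/2)^m" using elim(2) i by blast
        ultimately show "\<exists>y\<in>C t. dist y (g t) < e"
          using m dist_triangle3[of y "g t" "d i"] by (intro bexI[of _ y]) auto
      qed
    qed
  qed
  \<comment> \<open>The correspondence \<open>G\<close> is itself a constraint with closed values,
    so \<open>g\<close> inherits the bound \<open>h\<close>.\<close>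
  have "AE t in M. g t \<in> closure (G t)" using f(2) by (intro g_closure[OF G(1), of 0])
  with G(3) have "AE t in M. g t \<in> G t"
    by eventually_elim (simp add: closure_closed compact_imp_closed)
  then have g_bound: "AE t in M. norm (g t) \<le> h t"
    using h(2) by eventually_elim auto
  have g_int: "integrable M g"
    by (rule Bochner_Integration.integrable_bound[OF h(1) g_meas]) (use g_bound in auto)
  have f_bound: "AE t in M. norm (f n t) \<le> h t" for n
    using f(2)[of n] h(2) by eventually_elim auto

  \<comment> \<open>Step-function integrals for \<open>g\<close> and for \<open>f (r n)\<close>,
    built from the limit events and the original events. Both have the error bound
    \<open>R k m\<close>, which is uniform in \<open>n\<close>.\<close>
  define S where "S k m = (\<Sum>i<k. measure M (disjointed (\<lambda>i. E i m) i) *\<^sub>R d i)" for k m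
  define Sn where "Sn n k m = (\<Sum>i<k. measure M (disjointed (\<lambda>i. A (r n) (enc i m)) i) *\<^sub>R d i)" for n k m
  define R where "R k m = (1/2)^m * measure M (space M) + (\<integral>t. indicator (space M - K k m) t * h t \<partial>M)" for k m
  have gS: "norm (integral\<^sup>L M g - S k m) \<le> R k m" for k m
    unfolding S_def R_def
  proof (rule integral_near_simple[OF g_meas g_bound h(1) E _ K])
    show "AE t in M. \<forall>i. t \<in> E i m \<longrightarrow> dist (d i) (g t) \<le> (1/2)^m" using g_near by eventually_elim blast
    show "AE t in M. t \<in> K k m \<longrightarrow> (\<exists>i<k. t \<in> E i m)" using K_E by eventually_elim blast
  qed simp
  have fS: "norm (integral\<^sup>L M (f (r n)) - Sn n k m) \<le> R k m" for n k m
    unfolding Sn_def R_def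
  proof (rule integral_near_simple[OF f(1) f_bound h(1) A _ K])
    show "AE t in M. \<forall>i. t \<in> A (r n) (enc i m) \<longrightarrow> dist (d i) (f (r n) t) \<le> (1/2)^m"
      by (auto simp: A_enc U_def)
    show "AE t in M. t \<in> K k m \<longrightarrow> (\<exists>i<k. t \<in> A (r n) (enc i m))"
      using f(2)[of "r n"] AE_space by eventually_elim (auto simp: A_enc dest: K_cover)
  qed simp
  have S_lim: "(\<lambda>n. Sn n k m) \<longlonglongrightarrow> S k m" for k m
    unfolding S_def Sn_def
  proof (intro tendsto_sum tendsto_scaleR tendsto_const)
    fix i
    \<comment> \<open>Lying in the \<open>i\<close>-th ball but in none of the earlier ones is a
      condition on finitely many events, so the measures of the disjointed sets converge.\<close>
    let ?J = "(\<lambda>i. enc i m) ` {..i}" and ?P = "\<lambda>S. S (enc i m) \<and> (\<forall>j<i. \<not> S (enc j m))"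
    have eq: "disjointed (\<lambda>i. X (enc i m)) i = {t\<in>space M. ?P (\<lambda>j. j \<in> ?J \<and> t \<in> X j)}"
      if "\<And>j. X j \<in> sets M" for X
      using sets.sets_into_space[OF that] by (auto simp: disjointed_def)
    have "disjointed (\<lambda>i. A (r n) (enc i m)) i = {t\<in>space M. ?P (\<lambda>j. j \<in> ?J \<and> t \<in> A (r n) j)}" for n
      by (rule eq) (rule A)
    moreover have "disjointed (\<lambda>i. E i m) i = {t\<in>space M. ?P (\<lambda>j. j \<in> ?J \<and> t \<in> A' j)}"
      unfolding E_def by (rule eq) (rule A')
    ultimately show "(\<lambda>n. measure M (disjointed (\<lambda>i. A (r n) (enc i m)) i)) \<longlonglongrightarrow> measure M (disjointed (\<lambda>i. E i m) i)"
      using lim[where J = ?J and P = ?P, OF _ top] by simp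
  qed
  \<comment> \<open>Dominated convergence removes the integral of \<open>h\<close> off
    \<open>K k m\<close>; what remains is the error due to the radius of the balls.\<close>
  have R_lim: "(\<lambda>k. R k m) \<longlonglongrightarrow> (1/2)^m * measure M (space M)" for m
  proof -
    have "(\<lambda>k. \<integral>t. indicator (space M - K k m) t * h t \<partial>M) \<longlonglongrightarrow> (\<integral>t. 0 \<partial>M)"
    proof (rule integral_dominated_convergence[where w = "\<lambda>t. \<bar>h t\<bar>"])
      show "AE t in M. (\<lambda>k. indicator (space M - K k m) t * h t) \<longlonglongrightarrow> 0"
        using K_exhausts
      proof eventually_elim
        case (elim t)
        then obtain k0 where "t \<in> K k0 m" by blast
        then have "indicator (space M - K k m) t * h t = 0" if "k0 \<le> k" for k
          using K_mono[OF _ that] by simp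
        then show ?case by (intro tendsto_eventually) (auto simp: eventually_sequentially)
      qed
      show "AE t in M. norm (indicator (space M - K k m) t * h t) \<le> \<bar>h t\<bar>" for k
        by (auto simp: indicator_def)
    qed (use h(1) K in \<open>auto intro!: borel_measurable_times borel_measurable_indicator\<close>)
    from tendsto_add[OF tendsto_const[of "(1/2)^m * measure M (space M)"] this]
    show ?thesis by (simp add: R_def)
  qed
  have "(\<lambda>n. integral\<^sup>L M (f (r n))) \<longlonglongrightarrow> integral\<^sup>L M g"
  proof (rule metric_LIMSEQ_I)
    fix e :: real assume e: "0 < e"
    \<comment> \<open>The order of choices matters: first the radius through \<open>m\<close>, then
      the number \<open>k\<close> of balls for this \<open>m\<close>, and finally \<open>n\<close>,
      for which the finite sums are close.\<close>
    have "(\<lambda>m. (1/2)^m * measure M (space M)) \<longlonglongrightarrow> 0 * measure M (space M)"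
      by (intro tendsto_mult tendsto_const LIMSEQ_power_zero) simp
    then have "eventually (\<lambda>m. (1/2)^m * measure M (space M) < e / 4) sequentially"
      using e by (intro order_tendstoD) auto
    then obtain m where "(1/2)^m * measure M (space M) < e / 4"
      by (auto simp: eventually_sequentially)
    then have "eventually (\<lambda>k. R k m < e / 4) sequentially"
      by (rule order_tendstoD[OF R_lim])
    then obtain k where k: "R k m < e / 4" by (auto simp: eventually_sequentially)
    obtain n0 where n0: "\<And>n. n0 \<le> n \<Longrightarrow> dist (Sn n k m) (S k m) < e / 4"
      using metric_LIMSEQ_D[OF S_lim[of k m], of "e / 4"] e by auto
    show "\<exists>n0. \<forall>n\<ge>n0. dist (integral\<^sup>L M (f (r n))) (integral\<^sup>L M g) < e"
    proof (intro exI allI impI)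
      fix n assume n: "n0 \<le> n"
      have "dist (integral\<^sup>L M (f (r n))) (integral\<^sup>L M g) \<le>
          dist (integral\<^sup>L M (f (r n))) (Sn n k m) + dist (Sn n k m) (S k m) + dist (integral\<^sup>L M g) (S k m)"
        using dist_triangle[of "integral\<^sup>L M (f (r n))" "integral\<^sup>L M g" "Sn n k m"]
          dist_triangle2[of "Sn n k m" "integral\<^sup>L M g" "S k m"] by linarith
      also have "\<dots> < e"
        using n0[OF n] fS[of n k m] gS[of k m] k e unfolding dist_norm[of "integral\<^sup>L M _"] by linarith
      finally show "dist (integral\<^sup>L M (f (r n))) (integral\<^sup>L M g) < e" .
    qed
  qed
  moreover have "AE t in M. g t \<in> closure (C t)"
    if "measurable_correspondence N C" "\<forall>n\<ge>k. AE t in M. f n t \<in> C t" for C k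
    using that by (intro g_closure[of C k]) auto
  ultimately show ?thesis using r g_meas g_int by (intro exI[of _ r] exI[of _ g] conjI) auto
qed

end

section \<open>The weak topology and the two conclusions\<close>

text \<open>Each generator is the preimage of an open set under a norm continuous functional, and
  norm open sets are stable under the operations that generate a topology.\<close>

lemma openin_weak_topology_imp_open:
  fixes S :: "'x::real_normed_vector set"
  assumes "openin weak_topology S"
  shows "open S"
proof -
  have "generate_topology_on {\<phi> -` U | (\<phi> :: 'x \<Rightarrow> real) U. bounded_linear \<phi> \<and> open U} S"
    using assms by (simp add: weak_topology_def openin_topology_generated_by_iff)
  then show "open S"
  proof induction
    case (Basis s)
    then obtain \<phi> :: "'x \<Rightarrow> real" and U where "s = \<phi> -` U" "bounded_linear \<phi>" "open U" by blast
    then show ?case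
      by (simp add: open_vimage linear_continuous_on)
  qed (auto simp: open_Un open_Int)
qed

lemma closedin_weak_topology_imp_closed:
  assumes "closedin weak_topology S"
  shows "closed (S :: 'x::real_normed_vector set)"
proof -
  \<comment> \<open>The notion \<open>closedin\<close> takes complements within the topspace; the
    preimage of \<open>UNIV\<close> under the zero functional shows that this is the whole
    space.\<close>
  have "bounded_linear (\<lambda>x::'x. 0::real)" by (rule bounded_linear_zero)
  then have "(UNIV :: 'x set) \<in> {\<phi> -` U | (\<phi> :: 'x \<Rightarrow> real) U. bounded_linear \<phi> \<and> open U}"
    by (intro CollectI exI[of _ "\<lambda>x::'x. 0::real"] exI[of _ "UNIV :: real set"]) simp
  then have "topspace (weak_topology :: 'x topology) = UNIV"
    unfolding weak_topology_def topology_generated_by_topspace by blast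
  then have "open (UNIV - S)"
    using assms openin_weak_topology_imp_open by (auto simp: closedin_def)
  then show ?thesis by (simp add: closed_def Compl_eq_Diff_UNIV)
qed

text \<open>In a metric space sequential compactness suffices. In \<open>limit_selection\<close> the
  correspondence \<open>F\<close> serves both as the bounding \<open>G\<close> and as the
  constraint, and its compact values absorb the closure.\<close>

lemma (in nowhere_equivalent_subalg) compact_integral_correspondence:
  fixes F :: "'a \<Rightarrow> 'x::{banach, second_countable_topology} set"
  assumes gen: "countably_generated N"
    and F: "measurable_correspondence N F" "integrably_bounded M F" "AE t in M. compact (F t)"
  shows "compact (integral_correspondence M F)"
proof -
  have "seq_compact (integral_correspondence M F)"
  proof (rule seq_compactI)
    fix z :: "nat \<Rightarrow> 'x" assume "\<forall>n. z n \<in> integral_correspondence M F"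
    then have "\<forall>n. \<exists>f. f \<in> borel_measurable M \<and> (AE t in M. f t \<in> F t) \<and> z n = integral\<^sup>L M f"
      by (auto simp: integral_correspondence_def selection_def)
    then obtain f where f: "\<And>n. f n \<in> borel_measurable M" "\<And>n. AE t in M. f n t \<in> F t" "\<And>n. z n = integral\<^sup>L M (f n)"
      by metis
    obtain r g where r: "strict_mono (r :: nat \<Rightarrow> nat)" and g: "g \<in> borel_measurable M" "integrable M g"
      and lim: "(\<lambda>n. integral\<^sup>L M (f (r n))) \<longlonglongrightarrow> integral\<^sup>L M g"
      and cl: "\<forall>C k. measurable_correspondence N C \<longrightarrow> (\<forall>n\<ge>k. AE t in M. f n t \<in> C t) \<longrightarrow>
        (AE t in M. g t \<in> closure (C t))"
      using limit_selection[where f = f, OF gen F f(1,2)] by (elim exE conjE)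
    have "AE t in M. g t \<in> closure (F t)" using f(2) by (intro cl[rule_format, of F 0] F)
    with F(3) have "AE t in M. g t \<in> F t"
      by eventually_elim (simp add: closure_closed compact_imp_closed)
    then have "integral\<^sup>L M g \<in> integral_correspondence M F"
      using g by (auto simp: integral_correspondence_def selection_def)
    moreover have "(z \<circ> r) \<longlonglongrightarrow> integral\<^sup>L M g" using lim by (simp add: o_def f(3))
    ultimately show "\<exists>l\<in>integral_correspondence M F. \<exists>r. strict_mono r \<and> (z \<circ> r) \<longlonglongrightarrow> l"
      using r by blast
  qed
  then show ?thesis by (simp add: compact_eq_seq_compact_metric)
qed

text \<open>If the property fails at \<open>y0\<close>, there are points \<open>y n\<close> tending
  to \<open>y0\<close> and selections \<open>f n\<close> of \<open>F (t, y n)\<close> with integrals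
  outside \<open>V\<close>. The limit selection \<open>g\<close> turns out to be a selection at
  \<open>y0\<close>, so its integral lies in the open set \<open>V\<close>, and so do late integrals
  along the subsequence.\<close>

lemma (in nowhere_equivalent_subalg) upper_hemicontinuous_integral_correspondence:
  fixes G :: "'a \<Rightarrow> 'x::{banach, second_countable_topology} set"
    and F :: "'a \<times> 'y::metric_space \<Rightarrow> 'x set"
  assumes gen: "countably_generated N"
    and G: "measurable_correspondence N G" "integrably_bounded M G" "AE t in M. compact (G t)"
    and F_closed: "\<And>y. AE t in M. closed (F (t, y))"
    and F_G: "\<And>y. AE t in M. F (t, y) \<subseteq> G t"
    and F_meas: "\<And>y. measurable_correspondence N (\<lambda>t. F (t, y))"
    and F_uhc: "\<And>t. t \<in> space M \<Longrightarrow> upper_hemicontinuous (\<lambda>y. F (t, y))"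
  shows "upper_hemicontinuous (\<lambda>y. integral_correspondence M (\<lambda>t. F (t, y)))"
  unfolding upper_hemicontinuous_def
proof (intro conjI allI impI)
  show "correspondence UNIV (\<lambda>y. integral_correspondence M (\<lambda>t. F (t, y)))"
    unfolding correspondence_def
  proof
    fix y :: 'y
    obtain h where h: "integrable M h" "AE t in M. \<forall>x\<in>G t. norm x \<le> h t"
      using G(2) by (auto simp: integrably_bounded_def)
    \<comment> \<open>Closedness of \<open>F (t, y)\<close> for almost all \<open>t\<close> turns
      this into a selection, and the bound for \<open>G\<close> makes it integrable.\<close>
    obtain f where f: "f \<in> borel_measurable N" "\<forall>t\<in>space N. f t \<in> closure (F (t, y))"
      using measurable_selection_exists[OF F_meas[of y]] by (elim bexE)
    have f_M: "f \<in> borel_measurable M" using f(1) measurable_from_subalg[OF subalg] by blast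
    have sel: "AE t in M. f t \<in> F (t, y)"
      using F_closed[of y] AE_space
    proof eventually_elim
      case (elim t)
      have "f t \<in> closure (F (t, y))" using f(2) elim(2) unfolding space_sub by blast
      then show ?case using closure_closed[OF elim(1)] by simp
    qed
    have "AE t in M. norm (f t) \<le> h t"
      using sel F_G[of y] h(2) by eventually_elim blast
    then have "integrable M f"
      by (intro Bochner_Integration.integrable_bound[OF h(1) f_M]) auto
    then show "integral_correspondence M (\<lambda>t. F (t, y)) \<noteq> {}"
      using f_M sel by (auto simp: integral_correspondence_def selection_def)
  qed
next
  fix y0 :: 'y and V :: "'x set"
  let ?H = "\<lambda>y. integral_correspondence M (\<lambda>t. F (t, y))"
  assume V: "open V \<and> ?H y0 \<subseteq> V"
  show "\<exists>U. open U \<and> y0 \<in> U \<and> (\<forall>y\<in>U. ?H y \<subseteq> V)"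
  proof (rule ccontr)
    assume neg: "\<not> ?thesis"
    have "\<exists>y f. dist y0 y < (1/2)^n \<and> f \<in> borel_measurable M \<and> (AE t in M. f t \<in> F (t, y)) \<and> integral\<^sup>L M f \<notin> V" for n :: nat
    proof -
      have "open (ball y0 ((1/2)^n))" "y0 \<in> ball y0 ((1/2)^n)" by simp_all
      then have "\<not> (\<forall>y\<in>ball y0 ((1/2)^n). ?H y \<subseteq> V)" using neg by blast
      then obtain y where y: "y \<in> ball y0 ((1/2)^n)" "\<not> ?H y \<subseteq> V" by blast
      then obtain f where "f \<in> borel_measurable M" "AE t in M. f t \<in> F (t, y)" "integral\<^sup>L M f \<notin> V"
        unfolding integral_correspondence_def selection_def by blast
      with y(1) show ?thesis unfolding mem_ball by blast
    qed
    then obtain y f where y: "\<And>n. dist y0 (y n) < (1/2)^n"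
      and f: "\<And>n. f n \<in> borel_measurable M" "\<And>n. AE t in M. f n t \<in> F (t, y n)" "\<And>n. integral\<^sup>L M (f n) \<notin> V"
      by metis
    have f_G: "AE t in M. f n t \<in> G t" for n
      using f(2)[of n] F_G[of "y n"] by eventually_elim blast
    have y_lim: "y \<longlonglongrightarrow> y0"
    proof (rule metric_tendsto_imp_tendsto)
      show "(\<lambda>n. (1/2::real)^n) \<longlonglongrightarrow> 0" by (rule LIMSEQ_power_zero) simp
      show "eventually (\<lambda>n. dist (y n) y0 \<le> dist ((1/2::real)^n) 0) sequentially"
        using y by (intro always_eventually) (auto simp: dist_commute less_imp_le)
    qed
    obtain r g where r: "strict_mono (r :: nat \<Rightarrow> nat)" and g: "g \<in> borel_measurable M" "integrable M g"
      and lim: "(\<lambda>n. integral\<^sup>L M (f (r n))) \<longlonglongrightarrow> integral\<^sup>L M g"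
      and cl: "\<forall>C k. measurable_correspondence N C \<longrightarrow> (\<forall>n\<ge>k. AE t in M. f n t \<in> C t) \<longrightarrow>
        (AE t in M. g t \<in> closure (C t))"
      using limit_selection[where f = f, OF gen G f(1) f_G] by (elim exE conjE)
    \<comment> \<open>From index \<open>k\<close> on, every \<open>f n\<close> selects from the tail
      union, which is a countable union of \<open>N\<close>-measurable correspondences.\<close>
    have "AE t in M. g t \<in> closure (\<Union>n\<in>{k..}. F (t, y n))" for k
    proof (rule cl[rule_format, where k = k])
      show "measurable_correspondence N (\<lambda>t. \<Union>n\<in>{k..}. F (t, y n))"
        using F_meas by (intro measurable_correspondence_UN) auto
      show "AE t in M. f n t \<in> (\<Union>n\<in>{k..}. F (t, y n))" if "k \<le> n" for n
        using f(2)[of n] by eventually_elim (use that in auto)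
    qed
    then have "AE t in M. \<forall>k. g t \<in> closure (\<Union>n\<in>{k..}. F (t, y n))"
      by (simp add: AE_all_countable)
    with F_closed[of y0] AE_space have "AE t in M. g t \<in> F (t, y0)"
    proof eventually_elim
      case (elim t)
      show ?case
      proof (rule ccontr)
        assume "g t \<notin> F (t, y0)"
        then obtain e where e: "0 < e" "ball (g t) e \<subseteq> - F (t, y0)"
          using elim(1) open_contains_ball[of "- F (t, y0)"] by (auto simp: open_Compl)
        \<comment> \<open>Halving the radius leaves room: \<open>F (t, y0)\<close> avoids the open
          ball of radius \<open>e\<close>, hence lies in \<open>W\<close>, whose points are more
          than \<open>e / 2\<close> away from \<open>g t\<close>. Upper hemicontinuity keeps a whole
          tail of the \<open>F (t, y n)\<close> in \<open>W\<close>, so \<open>g t\<close> cannot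
          lie in the closure of that tail.\<close>
        define W where "W = - cball (g t) (e / 2)"
        have "open W" by (auto simp: W_def)
        have "F (t, y0) \<subseteq> W"
        proof
          fix x assume "x \<in> F (t, y0)"
          then have "x \<notin> ball (g t) e" using e by blast
          then show "x \<in> W" using e(1) by (simp add: W_def)
        qed
        with \<open>open W\<close> obtain Y where Y: "open Y" "y0 \<in> Y" "\<And>y. y \<in> Y \<Longrightarrow> F (t, y) \<subseteq> W"
          using F_uhc[OF elim(2)] unfolding upper_hemicontinuous_def by meson
        obtain k where k: "\<And>n. k \<le> n \<Longrightarrow> y n \<in> Y"
          using topological_tendstoD[OF y_lim Y(1,2)] by (auto simp: eventually_sequentially)
        have "g t \<in> closure (\<Union>n\<in>{k..}. F (t, y n))" using elim(3) by blast
        then obtain x where x: "x \<in> (\<Union>n\<in>{k..}. F (t, y n))" "dist x (g t) < e / 2"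
          unfolding closure_approachable using e(1) half_gt_zero by blast
        then have "x \<in> W" using Y(3) k by blast
        then show False using x(2) by (simp add: W_def dist_commute)
      qed
    qed
    then have "integral\<^sup>L M g \<in> ?H y0"
      using g by (auto simp: integral_correspondence_def selection_def)
    then have "integral\<^sup>L M g \<in> V" using V by blast
    then have "eventually (\<lambda>n. integral\<^sup>L M (f (r n)) \<in> V) sequentially"
      using V by (intro topological_tendstoD[OF lim]) auto
    then show False using f(3) by (auto simp: eventually_sequentially)
  qed
qed

theorem proposition2:
  fixes M N :: "'a measure"
  assumes "prob_space M" and "complete_measure M" and "atomless M"
    and "subalgebra M N" and "countably_generated N"
    and "nowhere_equivalent M N"
  shows
    "(\<forall>F :: 'a \<Rightarrow> 'x::{banach, second_countable_topology} set.
        measurable_correspondence N F \<and> integrably_bounded M F \<and> (AE t in M. compact (F t))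
        \<longrightarrow> compact (integral_correspondence M F))
     \<and>
     (\<forall>(G :: 'a \<Rightarrow> 'x set) (F :: 'a \<times> 'y::metric_space \<Rightarrow> 'x set).
        measurable_correspondence N G \<and> integrably_bounded M G \<and> (AE t in M. compact (G t)) \<and>
        correspondence (space M \<times> UNIV) F \<and>
        (\<forall>y. AE t in M. closedin weak_topology (F (t, y))) \<and>
        (\<forall>y. AE t in M. F (t, y) \<subseteq> G t) \<and>
        (\<forall>y. measurable_correspondence N (\<lambda>t. F (t, y))) \<and>
        (\<forall>t\<in>space M. upper_hemicontinuous (\<lambda>y. F (t, y)))
        \<longrightarrow> upper_hemicontinuous (\<lambda>y. integral_correspondence M (\<lambda>t. F (t, y))))"
proof -
  interpret prob_space M by fact
  interpret nowhere_equivalent_subalg M N by unfold_locales (use assms in auto)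
  show ?thesis
  proof (intro conjI allI impI; elim conjE)
    fix F :: "'a \<Rightarrow> 'x set"
    assume "measurable_correspondence N F" "integrably_bounded M F" "AE t in M. compact (F t)"
    then show "compact (integral_correspondence M F)"
      by (rule compact_integral_correspondence[OF assms(5)])
  next
    fix G :: "'a \<Rightarrow> 'x set" and F :: "'a \<times> 'y \<Rightarrow> 'x set"
    assume G: "measurable_correspondence N G" "integrably_bounded M G" "AE t in M. compact (G t)"
      and F: "\<forall>y. AE t in M. closedin weak_topology (F (t, y))" "\<forall>y. AE t in M. F (t, y) \<subseteq> G t"
        "\<forall>y. measurable_correspondence N (\<lambda>t. F (t, y))" "\<forall>t\<in>space M. upper_hemicontinuous (\<lambda>y. F (t, y))"
    have "AE t in M. closed (F (t, y))" for y
      using F(1)[rule_format, of y] by eventually_elim (rule closedin_weak_topology_imp_closed)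
    then show "upper_hemicontinuous (\<lambda>y. integral_correspondence M (\<lambda>t. F (t, y)))"
      using F(2-4) by (intro upper_hemicontinuous_integral_correspondence[OF assms(5) G]) auto
  qed
qed

end
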